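(* Let $A$ and $B$ be approximately unital Jordan operator algebras, and write $A^1$ for a Jordan operator algebra unitization of $A$ with $A\neq A^1$. Let $C$ be a unital Jordan operator algebra containing $B$ as a closed (Jordan) subalgebra. (1) Every real positive contractive linear map $T:A\to B$ extends to a unital real positive contractive linear map from $A^1$ to $C$. (2) Every real positive contractive projection on $A$ extends to a unital real positive contractive projection on $A^1$.
   Context: Scalars are complex and all maps are linear. A Jordan operator algebra is a norm-closed subspace $A$ of $B(H)$, $H$ a complex Hilbert space, with $a^2\in A$ for all $a\in A$ (equivalently, closed under $a\circ b=\frac12(ab+ba)$). It is unital if it has an identity of norm $1$; a map $T$ between unital algebras is unital if $T(1)=1$. $A$ is approximately unital if it has a Jordan contractive approximate identity, i.e. a net $(e_t)$ of contractions in $A$ with $e_t\circ a\to a$ in norm for all $a\in A$. A unitization $A^1\neq A$ of $A$ is a unital Jordan operator algebra containing $A$ isometrically as a closed Jordan subalgebra of codimension $1$, with $A^1=A+\mathbb{C}1$ (it is unique up to isometric Jordan isomorphism). An element $a\in A$ is real positive if $a+a^*\ge 0$ in $B(H)$ (equivalently, in any $C^*$-algebra containing $A$ as a Jordan subalgebra). A linear map between Jordan operator algebras is real positive if it takes real positive elements to real positive elements. A projection on a Banach space $X$ is an idempotent linear map $P:X\to X$. *)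

theory Defs
  imports "HOL-Analysis.Analysis"
begin

section \<open>Complex Hilbert spaces\<close>

text \<open>The inner product is linear in the first argument. Positive definiteness is contained in
  the axiom on the norm, and \<open>1 *\<^sub>C x = x\<close> in \<open>scaleR_scaleC\<close>.\<close>

class complex_hilbert_space = banach +
  fixes scaleC :: "complex \<Rightarrow> 'a \<Rightarrow> 'a"  (infixr \<open>*\<^sub>C\<close> 75)
    and cinner :: "'a \<Rightarrow> 'a \<Rightarrow> complex"
  assumes scaleC_add_right: "c *\<^sub>C (x + y) = c *\<^sub>C x + c *\<^sub>C y"
    and scaleC_add_left: "(c + d) *\<^sub>C x = c *\<^sub>C x + d *\<^sub>C x"
    and scaleC_scaleC: "c *\<^sub>C d *\<^sub>C x = (c * d) *\<^sub>C x"
    and scaleR_scaleC: "r *\<^sub>R x = complex_of_real r *\<^sub>C x"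
    and cinner_commute: "cinner x y = cnj (cinner y x)"
    and cinner_add_left: "cinner (x + y) z = cinner x z + cinner y z"
    and cinner_scaleC_left: "cinner (c *\<^sub>C x) y = c * cinner x y"
    and norm_power2_eq_cinner: "complex_of_real ((norm x)\<^sup>2) = cinner x x"

instantiation complex :: complex_hilbert_space
begin
definition "scaleC_complex c (x::complex) = c * x"
definition "cinner_complex (x::complex) y = x * cnj y"
instance
proof
  show "complex_of_real ((norm x)\<^sup>2) = cinner x x" for x :: complex
    unfolding cinner_complex_def by (rule complex_norm_square)
qed (simp_all add: scaleC_complex_def cinner_complex_def distrib_left distrib_right
    mult.assoc scaleR_conv_of_real mult.commute)
end

lemma scaleC_one [simp]: "1 *\<^sub>C (x::'h::complex_hilbert_space) = x"
  by (metis scaleR_scaleC of_real_1 scaleR_one)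

lemma cinner_add_right: "cinner x (y + z) = cinner x y + cinner x z"
  for x :: "'h::complex_hilbert_space"
  using cinner_commute[of x "y + z"] cinner_commute[of x y] cinner_commute[of x z]
  by (simp add: cinner_add_left)

lemma cinner_scaleC_right: "cinner x (c *\<^sub>C y) = cnj c * cinner x y"
  for x :: "'h::complex_hilbert_space"
  using cinner_commute[of x "c *\<^sub>C y"] cinner_commute[of x y]
  by (simp add: cinner_scaleC_left)

lemma cinner_scaleR_left: "cinner (r *\<^sub>R x) y = of_real r * cinner x y"
  for x :: "'h::complex_hilbert_space"
  by (simp add: scaleR_scaleC cinner_scaleC_left)

lemma cinner_scaleR_right: "cinner x (r *\<^sub>R y) = of_real r * cinner x y"
  for x :: "'h::complex_hilbert_space"
  by (simp add: scaleR_scaleC cinner_scaleC_right)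

lemma Re_cinner_commute: "Re (cinner x y) = Re (cinner y x)"
  for x :: "'h::complex_hilbert_space"
  by (subst cinner_commute) simp

lemma Re_cinner_self: "Re (cinner x x) = (norm x)\<^sup>2"
  for x :: "'h::complex_hilbert_space"
  by (metis norm_power2_eq_cinner Re_complex_of_real)

lemma norm_add_power2: "(norm (x + y))\<^sup>2 = (norm x)\<^sup>2 + 2 * Re (cinner x y) + (norm y)\<^sup>2"
  for x :: "'h::complex_hilbert_space"
proof -
  have "(norm (x + y))\<^sup>2 = Re (cinner (x + y) (x + y))"
    by (simp add: Re_cinner_self)
  also have "\<dots> = Re (cinner x x) + Re (cinner x y) + Re (cinner y x) + Re (cinner y y)"
    by (simp add: cinner_add_left cinner_add_right)
  finally show ?thesis
    by (simp add: Re_cinner_self Re_cinner_commute[of y x])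
qed

lemma norm_diff_power2: "(norm (x - y))\<^sup>2 = (norm x)\<^sup>2 - 2 * Re (cinner x y) + (norm y)\<^sup>2"
  for x :: "'h::complex_hilbert_space"
  using norm_add_power2[of x "- y"] cinner_scaleR_right[of x "-1" y] by simp

lemma Re_cinner_le: "Re (cinner x y) \<le> norm x * norm y"
  for x :: "'h::complex_hilbert_space"
proof -
  have "(norm (x + y))\<^sup>2 \<le> (norm x + norm y)\<^sup>2"
    by (intro power_mono norm_triangle_ineq) auto
  then show ?thesis
    by (simp add: norm_add_power2 power2_sum)
qed

lemma abs_Re_cinner_le: "\<bar>Re (cinner x y)\<bar> \<le> norm x * norm y"
  for x :: "'h::complex_hilbert_space"
  using Re_cinner_le[of x y] Re_cinner_le[of "- x" y] cinner_scaleR_left[of "-1" x y] by simp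

lemma cinner_extensional:
  fixes y z :: "'h::complex_hilbert_space"
  assumes "\<And>x. cinner x y = cinner x z"
  shows "y = z"
proof -
  have "(norm (y - z))\<^sup>2 = Re (cinner (y - z) (y + (-1) *\<^sub>R z))"
    by (simp add: Re_cinner_self)
  also have "\<dots> = 0"
    using assms[of "y - z"] by (simp only: cinner_add_right cinner_scaleR_right) simp
  finally show ?thesis by simp
qed

text \<open>Riesz representation, used only to see that the adjoint below is well defined.\<close>

lemma riesz_Re:
  fixes f :: "'h::complex_hilbert_space \<Rightarrow> real"
  assumes f: "bounded_linear f"
  obtains y where "\<And>x. f x = Re (cinner x y)"
proof -
  interpret f: bounded_linear f by (rule f)
  define J where "J x = (norm x)\<^sup>2 - 2 * f x" for x
  obtain K where K: "\<And>x. norm (f x) \<le> norm x * K"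
    using f.bounded by blast
  have lower: "- (K\<^sup>2) \<le> J x" for x
  proof -
    have "0 \<le> (norm x - K)\<^sup>2" by simp
    then show ?thesis using K[of x] by (simp add: J_def power2_diff abs_le_iff algebra_simps)
  qed
  have bdd: "bdd_below (range J)"
    by (rule bdd_belowI2[of _ "- (K\<^sup>2)"]) (rule lower)
  define m where "m = Inf (range J)"
  have m_le: "m \<le> J x" for x
    unfolding m_def by (intro cInf_lower bdd) auto
  have "\<exists>x. J x < m + e" if "e > 0" for e
    using cInf_lessD[of "range J" "m + e"] that by (auto simp: m_def)
  then have "\<exists>x. J x < m + 1 / real (Suc n)" for n
    by (simp del: of_nat_Suc)
  then obtain X where X: "\<And>n. J (X n) < m + 1 / real (Suc n)"
    by metis
  have para: "(norm (x - y))\<^sup>2 \<le> 2 * (J x + J y - 2 * m)" for x y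
  proof -
    have 1: "J ((1/2) *\<^sub>R (x + y)) = (1/4) * (norm (x + y))\<^sup>2 - (f x + f y)"
      by (simp only: J_def norm_scaleR f.scaleR f.add power_mult_distrib)
        (simp add: power2_eq_square algebra_simps)
    show ?thesis
      using m_le[of "(1/2) *\<^sub>R (x + y)"]
      unfolding 1 norm_add_power2 norm_diff_power2 by (simp add: J_def field_simps)
  qed
  have "Cauchy X"
  proof (rule metric_CauchyI)
    fix e :: real assume e: "e > 0"
    then obtain N where N: "4 / e\<^sup>2 < real N"
      using reals_Archimedean2 by blast
    have Npos: "real N > 0" using N e by (smt (verit) divide_pos_pos zero_less_power)
    have "dist (X i) (X j) < e" if "N \<le> i" "N \<le> j" for i j
    proof -
      have small: "1 / real (Suc k) \<le> 1 / real N" if "N \<le> k" for k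
        using that Npos by (intro divide_left_mono) auto
      have "(norm (X i - X j))\<^sup>2 \<le> 2 * (J (X i) + J (X j) - 2 * m)" by (rule para)
      also have "\<dots> < 4 / real N"
        using X[of i] X[of j] small[OF that(1)] small[OF that(2)] by simp
      also have "\<dots> < e\<^sup>2"
        using N e Npos by (simp add: field_simps)
      finally show ?thesis
        using e by (simp add: dist_norm power_less_imp_less_base)
    qed
    then show "\<exists>M. \<forall>m\<ge>M. \<forall>n\<ge>M. dist (X m) (X n) < e" by blast
  qed
  then obtain y where y: "X \<longlonglongrightarrow> y"
    using Cauchy_convergent convergent_def by blast
  have "(\<lambda>n. J (X n)) \<longlonglongrightarrow> J y"
    unfolding J_def by (intro tendsto_intros y f.tendsto)
  moreover have "(\<lambda>n. m + 1 / real (Suc n)) \<longlonglongrightarrow> m + 0"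
    by (intro tendsto_intros LIMSEQ_Suc[OF lim_1_over_n])
  ultimately have "J y \<le> m"
    using X by (intro LIMSEQ_le[of "\<lambda>n. J (X n)" "J y" "\<lambda>n. m + 1 / real (Suc n)" m])
      (auto intro: less_imp_le)
  have "f x = Re (cinner x y)" for x
  proof -
    define d where "d = Re (cinner x y) - f x"
    have quad: "0 \<le> t\<^sup>2 * (norm x)\<^sup>2 + 2 * t * d" for t
    proof -
      have "J y \<le> J (t *\<^sub>R x + y)" using m_le \<open>J y \<le> m\<close> order_trans by blast
      then show ?thesis
        by (simp add: J_def norm_add_power2 f.add f.scaleR cinner_scaleR_left d_def
            power_mult_distrib ring_distribs mult_ac)
    qed
    have "d = 0"
    proof (rule ccontr)
      assume d: "d \<noteq> 0"
      define t where "t = - d / ((norm x)\<^sup>2 + 1)"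
      have p: "(norm x)\<^sup>2 + 1 > 0" by (simp add: add_nonneg_pos)
      have td: "t * ((norm x)\<^sup>2 + 1) = - d" using p by (simp add: t_def)
      have "t\<^sup>2 * (norm x)\<^sup>2 + 2 * t * d = t * (t * ((norm x)\<^sup>2 + 1)) - t\<^sup>2 + 2 * t * d"
        by (simp add: algebra_simps power2_eq_square)
      also have "\<dots> = t * d - t\<^sup>2" unfolding td by (simp add: algebra_simps)
      also have "\<dots> < 0"
      proof -
        have "t * d = - (d\<^sup>2 / ((norm x)\<^sup>2 + 1))" by (simp add: t_def power2_eq_square)
        moreover have "d\<^sup>2 / ((norm x)\<^sup>2 + 1) > 0" using d p by simp
        ultimately show ?thesis by (smt (verit) zero_le_power2)
      qed
      finally show False using quad[of t] by simp
    qed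
    then show ?thesis by (simp add: d_def)
  qed
  then show ?thesis using that by blast
qed


section \<open>Operators\<close>

text \<open>The type \<open>'h \<Rightarrow>\<^sub>L 'h\<close> consists of the bounded real-linear operators; the complex-linear ones
  among them form \<open>B(H)\<close>, with the operator norm and the composition \<open>(o\<^sub>L)\<close>.\<close>

definition bounded_operators :: "('h::complex_hilbert_space \<Rightarrow>\<^sub>L 'h) set" where
  "bounded_operators = {a. \<forall>c x. blinfun_apply a (c *\<^sub>C x) = c *\<^sub>C blinfun_apply a x}"

lemma norm_scaleC: "norm (c *\<^sub>C x) = cmod c * norm x" for x :: "'h::complex_hilbert_space"
proof -
  have "complex_of_real ((norm (c *\<^sub>C x))\<^sup>2) = (c * cnj c) * cinner x x"
    by (simp only: norm_power2_eq_cinner cinner_scaleC_left cinner_scaleC_right mult.assoc)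
      (simp add: ac_simps)
  also have "\<dots> = complex_of_real ((cmod c * norm x)\<^sup>2)"
    by (simp only: norm_power2_eq_cinner[symmetric] complex_norm_square[symmetric]
        power_mult_distrib of_real_mult)
  finally have "(norm (c *\<^sub>C x))\<^sup>2 = (cmod c * norm x)\<^sup>2"
    by (simp only: of_real_eq_iff)
  then show ?thesis by simp
qed

lift_definition scaleC_op :: "complex \<Rightarrow> ('g::real_normed_vector \<Rightarrow>\<^sub>L 'h::complex_hilbert_space) \<Rightarrow> ('g \<Rightarrow>\<^sub>L 'h)"
  is "\<lambda>c a x. c *\<^sub>C a x"
proof -
  fix c :: complex and a :: "'g \<Rightarrow> 'h"
  assume "bounded_linear a"
  moreover have "bounded_linear (\<lambda>x::'h. c *\<^sub>C x)"
    by (rule bounded_linear_intro[of _ "cmod c"])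
      (simp_all add: scaleC_add_right scaleR_scaleC scaleC_scaleC norm_scaleC mult.commute)
  ultimately show "bounded_linear (\<lambda>x. c *\<^sub>C a x)"
    by (rule bounded_linear_compose[rotated])
qed

definition cadjoint :: "('h::complex_hilbert_space \<Rightarrow>\<^sub>L 'h) \<Rightarrow> ('h \<Rightarrow>\<^sub>L 'h)" where
  "cadjoint a = (THE b. \<forall>x y. cinner (blinfun_apply a x) y = cinner x (blinfun_apply b y))"

lemma cadjoint_exists1:
  fixes a :: "'h::complex_hilbert_space \<Rightarrow>\<^sub>L 'h"
  assumes a: "a \<in> bounded_operators"
  shows "\<exists>!b. \<forall>x y. cinner (blinfun_apply a x) y = cinner x (blinfun_apply b y)"
proof -
  have "\<exists>z. \<forall>x. cinner (a x) y = cinner x z" for y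
  proof -
    have "bounded_linear (\<lambda>x. Re (cinner (a x) y))"
    proof (rule bounded_linear_intro[of _ "norm a * norm y"])
      show "norm (Re (cinner (a x) y)) \<le> norm x * (norm a * norm y)" for x
      proof -
        have "\<bar>Re (cinner (a x) y)\<bar> \<le> norm (a x) * norm y" by (rule abs_Re_cinner_le)
        also have "\<dots> \<le> (norm a * norm x) * norm y"
          by (intro mult_right_mono norm_blinfun) auto
        finally show ?thesis by (simp add: mult_ac)
      qed
    qed (simp_all add: blinfun.add_right blinfun.scaleR_right cinner_add_left cinner_scaleR_left)
    then obtain z where z: "\<And>x. Re (cinner (a x) y) = Re (cinner x z)"
      by (rule riesz_Re) blast
    have "cinner (a x) y = cinner x z" for x
    proof (rule complex_eqI)
      have "a (\<i> *\<^sub>C x) = \<i> *\<^sub>C a x" using a by (simp add: bounded_operators_def)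
      then show "Im (cinner (a x) y) = Im (cinner x z)"
        using z[of "\<i> *\<^sub>C x"] by (simp add: cinner_scaleC_left)
    qed (rule z)
    then show ?thesis by blast
  qed
  then obtain g where g: "\<And>x y. cinner (a x) y = cinner x (g y)"
    by metis
  have "bounded_linear g"
  proof (rule bounded_linear_intro[of _ "norm a"])
    show "g (x + y) = g x + g y" for x y
      by (rule cinner_extensional) (simp add: g[symmetric] cinner_add_right)
    show "g (r *\<^sub>R x) = r *\<^sub>R g x" for r x
      by (rule cinner_extensional) (simp add: g[symmetric] cinner_scaleR_right)
    show "norm (g x) \<le> norm x * norm a" for x
    proof -
      have "(norm (g x))\<^sup>2 = Re (cinner (a (g x)) x)"
        by (simp add: g Re_cinner_self)
      also have "\<dots> \<le> norm (a (g x)) * norm x" by (rule Re_cinner_le)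
      also have "\<dots> \<le> (norm a * norm (g x)) * norm x"
        by (intro mult_right_mono norm_blinfun) auto
      finally have "norm (g x) * norm (g x) \<le> norm (g x) * (norm x * norm a)"
        by (simp add: power2_eq_square mult_ac)
      then show ?thesis
        by (cases "norm (g x) = 0") (simp_all add: mult_le_cancel_left)
    qed
  qed
  then have ex: "\<forall>x y. cinner (a x) y = cinner x (Blinfun g y)"
    by (simp add: g bounded_linear_Blinfun_apply)
  show ?thesis
  proof (rule ex1I[of _ "Blinfun g"])
    show "\<forall>x y. cinner (a x) y = cinner x (Blinfun g y)" by (rule ex)
    fix b assume b: "\<forall>x y. cinner (a x) y = cinner x (blinfun_apply b y)"
    show "b = Blinfun g"
    proof (rule blinfun_eqI)
      fix y
      show "blinfun_apply b y = blinfun_apply (Blinfun g) y"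
        by (rule cinner_extensional) (simp only: b[rule_format, symmetric] ex[rule_format, symmetric])
    qed
  qed
qed

lemma cinner_cadjoint:
  "a \<in> bounded_operators \<Longrightarrow> cinner (blinfun_apply a x) y = cinner x (blinfun_apply (cadjoint a) y)"
  unfolding cadjoint_def by (rule cadjoint_exists1[THEN theI', rule_format])

definition positive_operator :: "('h::complex_hilbert_space \<Rightarrow>\<^sub>L 'h) \<Rightarrow> bool" where
  "positive_operator a \<longleftrightarrow>
     a \<in> bounded_operators \<and> (\<forall>x. cinner (blinfun_apply a x) x \<in> \<real>\<^sub>\<ge>\<^sub>0)"

definition real_positive :: "('h::complex_hilbert_space \<Rightarrow>\<^sub>L 'h) \<Rightarrow> bool" where
  "real_positive a \<longleftrightarrow> positive_operator (a + cadjoint a)"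


section \<open>Jordan operator algebras\<close>

definition jordan_prod :: "('h::complex_hilbert_space \<Rightarrow>\<^sub>L 'h) \<Rightarrow> ('h \<Rightarrow>\<^sub>L 'h) \<Rightarrow> ('h \<Rightarrow>\<^sub>L 'h)"
  (infixl \<open>\<circ>\<^sub>J\<close> 70) where
  "a \<circ>\<^sub>J b = (1/2) *\<^sub>R ((a o\<^sub>L b) + (b o\<^sub>L a))"

definition jordan_operator_algebra :: "('h::complex_hilbert_space \<Rightarrow>\<^sub>L 'h) set \<Rightarrow> bool" where
  "jordan_operator_algebra A \<longleftrightarrow>
     A \<subseteq> bounded_operators \<and>
     0 \<in> A \<and> (\<forall>a\<in>A. \<forall>b\<in>A. a + b \<in> A) \<and> (\<forall>c. \<forall>a\<in>A. scaleC_op c a \<in> A) \<and>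
     closed A \<and>
     (\<forall>a\<in>A. a o\<^sub>L a \<in> A)"

text \<open>The identity need not be the identity operator of the ambient Hilbert space.\<close>

definition is_identity :: "('h::complex_hilbert_space \<Rightarrow>\<^sub>L 'h) set \<Rightarrow> ('h \<Rightarrow>\<^sub>L 'h) \<Rightarrow> bool" where
  "is_identity A e \<longleftrightarrow> e \<in> A \<and> norm e = 1 \<and> (\<forall>a\<in>A. e \<circ>\<^sub>J a = a)"

definition identity_of :: "('h::complex_hilbert_space \<Rightarrow>\<^sub>L 'h) set \<Rightarrow> ('h \<Rightarrow>\<^sub>L 'h)" where
  "identity_of A = (THE e. is_identity A e)"

definition unital_jordan_operator_algebra :: "('h::complex_hilbert_space \<Rightarrow>\<^sub>L 'h) set \<Rightarrow> bool" where
  "unital_jordan_operator_algebra A \<longleftrightarrow> jordan_operator_algebra A \<and> (\<exists>e. is_identity A e)"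

lemma is_identity_unique:
  assumes "is_identity A e" "is_identity A f"
  shows "e = f"
proof -
  have "e \<circ>\<^sub>J f = f" "f \<circ>\<^sub>J e = e"
    using assms unfolding is_identity_def by blast+
  moreover have "e \<circ>\<^sub>J f = f \<circ>\<^sub>J e"
    unfolding jordan_prod_def by (simp only: add.commute)
  ultimately show ?thesis by argo
qed

lemma identity_of_eq: "is_identity A e \<Longrightarrow> identity_of A = e"
  unfolding identity_of_def by (rule the_equality, assumption, erule is_identity_unique)

text \<open>Nets are rendered by proper filters: a net of contractions in \<open>A\<close> induces its filter of
  tails, and a proper filter as below comes from a net of contractions in \<open>A\<close> (indexed by the
  pairs of a member of the filter and a contraction in \<open>A\<close> belonging to it).\<close>

definition approximately_unital :: "('h::complex_hilbert_space \<Rightarrow>\<^sub>L 'h) set \<Rightarrow> bool" where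
  "approximately_unital A \<longleftrightarrow>
     (\<exists>F. F \<noteq> bot \<and> (\<forall>\<^sub>F e in F. e \<in> A \<and> norm e \<le> 1) \<and>
          (\<forall>a\<in>A. ((\<lambda>e. e \<circ>\<^sub>J a) \<longlongrightarrow> a) F))"


section \<open>Maps\<close>

definition complex_linear_map ::
  "('h::complex_hilbert_space \<Rightarrow>\<^sub>L 'h) set \<Rightarrow> ('k::complex_hilbert_space \<Rightarrow>\<^sub>L 'k) set \<Rightarrow>
   (('h \<Rightarrow>\<^sub>L 'h) \<Rightarrow> ('k \<Rightarrow>\<^sub>L 'k)) \<Rightarrow> bool" where
  "complex_linear_map A B T \<longleftrightarrow>
     T \<in> A \<rightarrow> B \<and>
     (\<forall>a\<in>A. \<forall>b\<in>A. T (a + b) = T a + T b) \<and>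
     (\<forall>c. \<forall>a\<in>A. T (scaleC_op c a) = scaleC_op c (T a))"

definition real_positive_contraction ::
  "('h::complex_hilbert_space \<Rightarrow>\<^sub>L 'h) set \<Rightarrow> ('k::complex_hilbert_space \<Rightarrow>\<^sub>L 'k) set \<Rightarrow>
   (('h \<Rightarrow>\<^sub>L 'h) \<Rightarrow> ('k \<Rightarrow>\<^sub>L 'k)) \<Rightarrow> bool" where
  "real_positive_contraction A B T \<longleftrightarrow>
     complex_linear_map A B T \<and>
     (\<forall>a\<in>A. real_positive a \<longrightarrow> real_positive (T a)) \<and>
     (\<forall>a\<in>A. norm (T a) \<le> norm a)"

definition real_positive_contractive_projection ::
  "('h::complex_hilbert_space \<Rightarrow>\<^sub>L 'h) set \<Rightarrow> (('h \<Rightarrow>\<^sub>L 'h) \<Rightarrow> ('h \<Rightarrow>\<^sub>L 'h)) \<Rightarrow> bool" where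
  "real_positive_contractive_projection A P \<longleftrightarrow>
     real_positive_contraction A A P \<and> (\<forall>a\<in>A. P (P a) = P a)"

definition unital_map ::
  "('h::complex_hilbert_space \<Rightarrow>\<^sub>L 'h) set \<Rightarrow> ('k::complex_hilbert_space \<Rightarrow>\<^sub>L 'k) set \<Rightarrow>
   (('h \<Rightarrow>\<^sub>L 'h) \<Rightarrow> ('k \<Rightarrow>\<^sub>L 'k)) \<Rightarrow> bool" where
  "unital_map A B T \<longleftrightarrow> T (identity_of A) = identity_of B"

text \<open>Containment of one Jordan operator algebra in another that may act on a different Hilbert
  space; \<open>A \<subseteq> B\<close> is the case where \<open>j\<close> is the identity map. The image is complete, hence closed.\<close>

definition isometric_jordan_embedding ::
  "('h::complex_hilbert_space \<Rightarrow>\<^sub>L 'h) set \<Rightarrow> ('k::complex_hilbert_space \<Rightarrow>\<^sub>L 'k) set \<Rightarrow>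
   (('h \<Rightarrow>\<^sub>L 'h) \<Rightarrow> ('k \<Rightarrow>\<^sub>L 'k)) \<Rightarrow> bool" where
  "isometric_jordan_embedding A B j \<longleftrightarrow>
     complex_linear_map A B j \<and>
     (\<forall>a\<in>A. norm (j a) = norm a) \<and>
     (\<forall>a\<in>A. \<forall>b\<in>A. j (a \<circ>\<^sub>J b) = j a \<circ>\<^sub>J j b)"

text \<open>The last two conditions say that \<open>A1\<close> is spanned by the image of \<open>A\<close> and the identity, and
  that this image is proper; so the image has codimension 1. If \<open>A\<close> is already unital, its identity
  is thus not that of \<open>A1\<close>.\<close>

definition unitization ::
  "('h::complex_hilbert_space \<Rightarrow>\<^sub>L 'h) set \<Rightarrow> ('k::complex_hilbert_space \<Rightarrow>\<^sub>L 'k) set \<Rightarrow>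
   (('h \<Rightarrow>\<^sub>L 'h) \<Rightarrow> ('k \<Rightarrow>\<^sub>L 'k)) \<Rightarrow> bool" where
  "unitization A A1 j \<longleftrightarrow>
     unital_jordan_operator_algebra A1 \<and>
     isometric_jordan_embedding A A1 j \<and>
     A1 = {j a + scaleC_op c (identity_of A1) | a c. a \<in> A} \<and>
     j ` A \<noteq> A1"

end

theory Submission
  imports Defs
begin

text \<open>
Write \<open>p\<close> and \<open>q\<close> for the identities of \<open>A1\<close> and \<open>C\<close>. The extension has to be
\<open>S (j a + c p) = k (T a) + c q\<close>, and for \<open>T = P\<close>, \<open>k = j\<close> this \<open>S\<close> is visibly idempotent, so
everything rests on \<open>S\<close> being real positive and contractive.

Contractivity follows from real positivity. For \<open>x\<close> in the open unit ball and \<open>z\<close> on the unit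
circle, the Cayley transform \<open>(1 + z x) (1 - z x)\<^sup>-\<^sup>1 = 1 + 2 (z x + (z x)\<^sup>2 + \<dots>)\<close> is real positive,
hence so is its image under \<open>S\<close>; the coefficient \<open>S x\<close> is recovered by averaging over roots of
unity \<open>z\<close>, and positivity bounds it by the constant coefficient \<open>S p = q\<close>
(\<open>unital_real_positive_contractive\<close>).

For real positivity, let \<open>j a + c p\<close> be real positive. Then \<open>r = Re c\<close> is nonnegative, since a real
positive \<open>j a - s p\<close> with \<open>s > 0\<close> would make \<open>j a\<close> invertible and put \<open>p\<close> into the image of \<open>A\<close>. So
\<open>Re (j a) \<ge> - r\<close>, and \<open>Re (k (T a)) \<ge> - r\<close> is wanted. The map \<open>T\<close> only knows about real positive
elements of \<open>A\<close>, so one needs \<open>d\<close> in \<open>A\<close> with \<open>norm d \<le> r + \<delta>\<close> and \<open>a + d\<close> real positive: then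
\<open>Re (T a) \<ge> - Re (T d) \<ge> - (r + \<delta>)\<close>. In the bidual of \<open>A\<close> the multiple \<open>r e\<close> of its identity \<open>e\<close>
would do with \<open>\<delta> = 0\<close>. Inside \<open>A\<close> one takes a series \<open>r e\<^sub>0\<^sup>2 + \<delta>/2 e\<^sub>1\<^sup>2 + \<delta>/4 e\<^sub>2\<^sup>2 + \<dots>\<close>, where each
\<open>e\<^sub>n\<close> is a contraction that is almost an identity for the element reached so far and almost
selfadjoint, and each term absorbs the error left by the one before
(\<open>accretive_dominating_element\<close>). That such \<open>e\<^sub>n\<close> exist is where the contractive approximate
identity enters: it acts as an identity on each side separately
(\<open>approximate_identity_two_sided\<close>), and averaging makes it nearly selfadjoint
(\<open>nearly_selfadjoint_unit\<close>).

The copies of \<open>A\<close> in \<open>A1\<close> and of \<open>B\<close> in \<open>C\<close> act on other Hilbert spaces; real positivity passes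
between them because it can be read off from the norm and the Jordan product alone
(\<open>embedding_accretive\<close>).
\<close>

section \<open>Operators\<close>

text \<open>On complex linear operators this is \<open>real_positive\<close>, expressed without the adjoint.\<close>

definition accretive :: "('h::complex_hilbert_space \<Rightarrow>\<^sub>L 'h) \<Rightarrow> bool" where
  "accretive a \<longleftrightarrow> (\<forall>x. 0 \<le> Re (cinner (blinfun_apply a x) x))"

lemma cinner_diff_left: "cinner (x - y) z = cinner x z - cinner y z"
  for x :: "'h::complex_hilbert_space"
  using cinner_add_left[of "x - y" y z] by simp

lemma cinner_diff_right: "cinner x (y - z) = cinner x y - cinner x z"
  for x :: "'h::complex_hilbert_space"
  using cinner_add_right[of x "y - z" z] by simp

lemma cinner_zero_left [simp]: "cinner 0 x = 0" for x :: "'h::complex_hilbert_space"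
  using cinner_diff_left[of x x x] by simp

lemma cinner_sum_left: "cinner (sum f I) y = (\<Sum>i\<in>I. cinner (f i) y)"
  for y :: "'h::complex_hilbert_space"
  by (induction I rule: infinite_finite_induct) (simp_all add: cinner_add_left)

lemmas blinfun_linear =
  blinfun.add_left blinfun.add_right blinfun.diff_left blinfun.diff_right
  blinfun.scaleR_left blinfun.scaleR_right blinfun.minus_left blinfun.minus_right
  blinfun.zero_left blinfun.zero_right

lemmas compose_linear =
  bounded_bilinear.add_left[OF bounded_bilinear_blinfun_compose]
  bounded_bilinear.add_right[OF bounded_bilinear_blinfun_compose]
  bounded_bilinear.diff_left[OF bounded_bilinear_blinfun_compose]
  bounded_bilinear.diff_right[OF bounded_bilinear_blinfun_compose]
  bounded_bilinear.minus_left[OF bounded_bilinear_blinfun_compose]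
  bounded_bilinear.minus_right[OF bounded_bilinear_blinfun_compose]
  bounded_bilinear.scaleR_left[OF bounded_bilinear_blinfun_compose]
  bounded_bilinear.scaleR_right[OF bounded_bilinear_blinfun_compose]

lemma blinfun_compose_assoc: "(a o\<^sub>L b) o\<^sub>L c = a o\<^sub>L (b o\<^sub>L c)"
  by (rule blinfun_eqI) simp

lemma norm_blinfun_le: "norm a \<le> c \<Longrightarrow> norm (blinfun_apply a x) \<le> c * norm x"
  by (meson norm_blinfun mult_right_mono norm_ge_zero order_trans)

lemma norm_contraction: "norm a \<le> 1 \<Longrightarrow> norm (blinfun_apply a x) \<le> norm x"
  using norm_blinfun_le[of a 1 x] by simp

lemma norm_compose_le:
  "norm a \<le> c \<Longrightarrow> norm b \<le> d \<Longrightarrow> norm (a o\<^sub>L b) \<le> c * d"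
  by (meson norm_blinfun_compose mult_mono norm_ge_zero order_trans)

lemma scaleC_op_of_real: "scaleC_op (complex_of_real r) a = r *\<^sub>R a"
  by (rule blinfun_eqI) (simp add: scaleC_op.rep_eq scaleR_scaleC blinfun.scaleR_left)

lemma scaleC_op_apply [simp]: "blinfun_apply (scaleC_op c a) x = c *\<^sub>C blinfun_apply a x"
  by (simp add: scaleC_op.rep_eq)

lemma cadjoint_eqI:
  assumes "\<And>x y. cinner (blinfun_apply a x) y = cinner x (blinfun_apply b y)"
    and "a \<in> bounded_operators"
  shows "cadjoint a = b"
  using cadjoint_exists1[OF assms(2)] cinner_cadjoint[OF assms(2)] assms(1) by blast

lemma cadjoint_in_bounded_operators:
  assumes "a \<in> bounded_operators"
  shows "cadjoint a \<in> bounded_operators"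
  unfolding bounded_operators_def
proof (intro CollectI allI)
  fix c x
  show "cadjoint a (c *\<^sub>C x) = c *\<^sub>C cadjoint a x"
    by (rule cinner_extensional)
      (simp add: cinner_cadjoint[OF assms, symmetric] cinner_scaleC_right)
qed

lemma cinner_cadjoint_left:
  assumes "a \<in> bounded_operators"
  shows "cinner (cadjoint a x) y = cinner x (blinfun_apply a y)"
  by (metis assms cinner_cadjoint cinner_commute)

lemma cadjoint_half_sum:
  assumes "a \<in> bounded_operators" "b \<in> bounded_operators" "(1/2) *\<^sub>R (a + b) \<in> bounded_operators"
  shows "cadjoint ((1/2) *\<^sub>R (a + b)) = (1/2) *\<^sub>R (cadjoint a + cadjoint b)"
  by (rule cadjoint_eqI)
    (simp_all add: assms blinfun_linear cinner_scaleR_left cinner_scaleR_right cinner_add_left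
      cinner_add_right cinner_cadjoint del: scaleR_half_double)

lemma norm_cadjoint_le:
  assumes a: "a \<in> bounded_operators"
  shows "norm (cadjoint a) \<le> norm a"
proof (rule norm_blinfun_bound)
  fix x
  let ?y = "cadjoint a x"
  have "(norm ?y)\<^sup>2 = Re (cinner (a ?y) x)"
    by (simp add: cinner_cadjoint[OF a] Re_cinner_self)
  also have "\<dots> \<le> norm (a ?y) * norm x" by (rule Re_cinner_le)
  also have "\<dots> \<le> (norm a * norm ?y) * norm x"
    by (intro mult_right_mono norm_blinfun) auto
  finally have "norm ?y * norm ?y \<le> norm ?y * (norm a * norm x)"
    by (simp add: power2_eq_square mult_ac)
  then show "norm ?y \<le> norm a * norm x"
    by (cases "norm ?y = 0") (simp_all add: mult_le_cancel_left)
qed simp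

lemma real_positive_iff_accretive:
  assumes a: "a \<in> bounded_operators"
  shows "real_positive a \<longleftrightarrow> accretive a"
proof -
  have "a + cadjoint a \<in> bounded_operators"
    using a cadjoint_in_bounded_operators[OF a]
    by (simp add: bounded_operators_def blinfun.add_left scaleC_add_right)
  moreover have "cinner ((a + cadjoint a) x) x = complex_of_real (2 * Re (cinner (a x) x))" for x
  proof -
    have "cinner ((a + cadjoint a) x) x = cinner (a x) x + cnj (cinner (a x) x)"
      using cinner_commute[of x "a x"]
      by (simp add: blinfun.add_left cinner_add_left cinner_cadjoint_left[OF a])
    then show ?thesis by (simp only: complex_add_cnj)
  qed
  ultimately show ?thesis
    by (simp only: real_positive_def positive_operator_def accretive_def simp_thms
        nonneg_Reals_of_real_iff) simp
qed

lemma norm_power2_scaled_diff: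
  fixes a :: "'h::complex_hilbert_space \<Rightarrow>\<^sub>L 'h"
  shows "(norm (r *\<^sub>R x - blinfun_apply a x))\<^sup>2
    = r\<^sup>2 * (norm x)\<^sup>2 - 2 * r * Re (cinner (a x) x) + (norm (a x))\<^sup>2"
  by (simp add: norm_diff_power2 cinner_scaleR_left power_mult_distrib Re_cinner_commute[of x])

section \<open>Jordan operator algebras\<close>

lemma jordan_prod_commute: "a \<circ>\<^sub>J b = b \<circ>\<^sub>J a"
  by (simp add: jordan_prod_def add.commute)

lemma jordan_prod_commuting: "a o\<^sub>L b = b o\<^sub>L a \<Longrightarrow> a \<circ>\<^sub>J b = a o\<^sub>L b"
  by (simp add: jordan_prod_def flip: scaleR_2)

text \<open>Commuting with \<open>a\<close> survives one step of the recursion in \<open>embedding_accretive\<close>. The step is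
  written with the Jordan product, which is the only product that an embedding respects.\<close>

lemma compose_commute_jordan_step:
  assumes h: "a o\<^sub>L u = u o\<^sub>L a"
  shows "a o\<^sub>L (t *\<^sub>R (r *\<^sub>R u - a \<circ>\<^sub>J u)) = (t *\<^sub>R (r *\<^sub>R u - a \<circ>\<^sub>J u)) o\<^sub>L a"
  unfolding jordan_prod_commuting[OF h]
  by (simp only: compose_linear blinfun_compose_assoc h[symmetric])

context
  fixes A :: "('h::complex_hilbert_space \<Rightarrow>\<^sub>L 'h) set"
  assumes A: "jordan_operator_algebra A"
begin

lemma jordan_algebra_bounded: "a \<in> A \<Longrightarrow> a \<in> bounded_operators"
  using A by (auto simp: jordan_operator_algebra_def)

lemma jordan_algebra_zero: "0 \<in> A"
  using A by (simp add: jordan_operator_algebra_def)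

lemma jordan_algebra_add: "a \<in> A \<Longrightarrow> b \<in> A \<Longrightarrow> a + b \<in> A"
  using A by (simp add: jordan_operator_algebra_def)

lemma jordan_algebra_scaleC: "a \<in> A \<Longrightarrow> scaleC_op c a \<in> A"
  using A by (simp add: jordan_operator_algebra_def)

lemma jordan_algebra_scaleR: "a \<in> A \<Longrightarrow> r *\<^sub>R a \<in> A"
  using jordan_algebra_scaleC[of a "complex_of_real r"] by (simp add: scaleC_op_of_real)

lemma jordan_algebra_diff: "a \<in> A \<Longrightarrow> b \<in> A \<Longrightarrow> a - b \<in> A"
  using jordan_algebra_add[of a "(-1) *\<^sub>R b"] jordan_algebra_scaleR[of b "-1"] by simp

lemma jordan_algebra_sum: "(\<And>i. i \<in> I \<Longrightarrow> f i \<in> A) \<Longrightarrow> sum f I \<in> A"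
  by (induction I rule: infinite_finite_induct) (auto simp: jordan_algebra_zero jordan_algebra_add)

lemma jordan_algebra_square: "a \<in> A \<Longrightarrow> a o\<^sub>L a \<in> A"
  using A by (simp add: jordan_operator_algebra_def)

lemma jordan_algebra_closed: "closed A"
  using A by (simp add: jordan_operator_algebra_def)

lemma jordan_algebra_jordan_prod:
  assumes "a \<in> A" "b \<in> A"
  shows "a \<circ>\<^sub>J b \<in> A"
proof -
  have "a \<circ>\<^sub>J b = (1/2) *\<^sub>R (((a + b) o\<^sub>L (a + b)) - (a o\<^sub>L a) - (b o\<^sub>L b))"
    by (simp add: jordan_prod_def compose_linear algebra_simps)
  then show ?thesis
    using assms by (simp add: jordan_algebra_scaleR jordan_algebra_diff jordan_algebra_add
        jordan_algebra_square)
qed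

lemma jordan_algebra_real_positive: "a \<in> A \<Longrightarrow> real_positive a \<longleftrightarrow> accretive a"
  by (simp add: real_positive_iff_accretive jordan_algebra_bounded)

end

context
  fixes A :: "('h::complex_hilbert_space \<Rightarrow>\<^sub>L 'h) set"
    and B :: "('k::complex_hilbert_space \<Rightarrow>\<^sub>L 'k) set" and j
  assumes A: "jordan_operator_algebra A" and j: "isometric_jordan_embedding A B j"
begin

lemma embedding_in: "a \<in> A \<Longrightarrow> j a \<in> B"
  using j by (auto simp: isometric_jordan_embedding_def complex_linear_map_def)

lemma embedding_add: "a \<in> A \<Longrightarrow> b \<in> A \<Longrightarrow> j (a + b) = j a + j b"
  using j by (simp add: isometric_jordan_embedding_def complex_linear_map_def)

lemma embedding_scaleC: "a \<in> A \<Longrightarrow> j (scaleC_op c a) = scaleC_op c (j a)"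
  using j by (simp add: isometric_jordan_embedding_def complex_linear_map_def)

lemma embedding_scaleR: "a \<in> A \<Longrightarrow> j (r *\<^sub>R a) = r *\<^sub>R j a"
  using embedding_scaleC[of a "complex_of_real r"] by (simp add: scaleC_op_of_real)

lemma embedding_diff: "a \<in> A \<Longrightarrow> b \<in> A \<Longrightarrow> j (a - b) = j a - j b"
  using embedding_add[of a "(-1) *\<^sub>R b"] embedding_scaleR[of b "-1"]
    jordan_algebra_scaleR[OF A, of b "-1"] by simp

lemma embedding_norm: "a \<in> A \<Longrightarrow> norm (j a) = norm a"
  using j by (simp add: isometric_jordan_embedding_def)

lemma embedding_jordan_prod: "a \<in> A \<Longrightarrow> b \<in> A \<Longrightarrow> j (a \<circ>\<^sub>J b) = j a \<circ>\<^sub>J j b"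
  using j by (simp add: isometric_jordan_embedding_def)

lemma embedding_inj: "inj_on j A"
proof (rule inj_onI)
  fix a b assume ab: "a \<in> A" "b \<in> A" "j a = j b"
  then have "norm (j (a - b)) = 0"
    by (simp add: embedding_diff)
  with ab show "a = b"
    by (simp add: embedding_norm jordan_algebra_diff[OF A])
qed

text \<open>Closedness of the image is completeness of \<open>A\<close> carried over by an isometry.\<close>

lemma embedding_image_jordan_algebra:
  assumes B: "jordan_operator_algebra B"
  shows "jordan_operator_algebra (j ` A)"
proof -
  have "complete (j ` A)"
    unfolding complete_def
  proof (intro allI impI)
    fix f :: "nat \<Rightarrow> 'k \<Rightarrow>\<^sub>L 'k" assume f: "(\<forall>n. f n \<in> j ` A) \<and> Cauchy f"
    then have "\<forall>n. \<exists>a. a \<in> A \<and> f n = j a" by blast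
    then obtain g where g: "\<And>n. g n \<in> A" "\<And>n. f n = j (g n)"
      by metis
    have dist: "dist (j a) (j b) = dist a b" if "a \<in> A" "b \<in> A" for a b
      using that embedding_norm[of "a - b"]
      by (simp add: dist_norm embedding_diff jordan_algebra_diff[OF A])
    have "Cauchy g"
      using f by (simp add: Cauchy_def g dist)
    then obtain l where l: "g \<longlonglongrightarrow> l"
      using Cauchy_convergent convergent_def by blast
    then have lA: "l \<in> A"
      using closed_sequentially[OF jordan_algebra_closed[OF A]] g(1) by blast
    have "f \<longlonglongrightarrow> j l"
      using l unfolding tendsto_iff g(2) dist[OF g(1) lA] .
    with lA show "\<exists>l\<in>j ` A. f \<longlonglongrightarrow> l" by blast
  qed
  moreover have "j a o\<^sub>L j a \<in> j ` A" if "a \<in> A" for a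
    using that embedding_jordan_prod[OF that that] jordan_algebra_square[OF A that]
    by (metis imageI jordan_prod_commuting)
  moreover have "0 \<in> j ` A"
    using embedding_scaleR[OF jordan_algebra_zero[OF A], of 0] jordan_algebra_zero[OF A]
    by (simp add: image_iff) (metis)
  moreover have "j a + j b \<in> j ` A" if "a \<in> A" "b \<in> A" for a b
    using that by (metis embedding_add imageI jordan_algebra_add[OF A])
  moreover have "scaleC_op c (j a) \<in> j ` A" if "a \<in> A" for a c
    using that by (metis embedding_scaleC imageI jordan_algebra_scaleC[OF A])
  moreover have "j ` A \<subseteq> bounded_operators"
    using embedding_in jordan_algebra_bounded[OF B] by blast
  ultimately show ?thesis
    unfolding jordan_operator_algebra_def by (blast intro: complete_imp_closed)
qed

text \<open>Makes each fact about embeddings usable in both directions between \<open>A\<close> and its image.\<close>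

lemma embedding_inverse: "isometric_jordan_embedding (j ` A) A (inv_into A j)"
proof -
  have inv: "inv_into A j (j a) = a" if "a \<in> A" for a
    using that embedding_inj by simp
  have "inv_into A j (j a + j b) = a + b" if "a \<in> A" "b \<in> A" for a b
    using that by (metis inv embedding_add jordan_algebra_add[OF A])
  moreover have "inv_into A j (scaleC_op c (j a)) = scaleC_op c a" if "a \<in> A" for a c
    using that by (metis inv embedding_scaleC jordan_algebra_scaleC[OF A])
  moreover have "inv_into A j (j a \<circ>\<^sub>J j b) = a \<circ>\<^sub>J b" if "a \<in> A" "b \<in> A" for a b
    using that by (metis inv embedding_jordan_prod jordan_algebra_jordan_prod[OF A])
  ultimately show ?thesis
    unfolding isometric_jordan_embedding_def complex_linear_map_def
    by (simp add: inv embedding_norm Pi_iff)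
qed

end

section \<open>Real positivity is intrinsic\<close>

text \<open>The inequality says that \<open>a (s + a)\<^sup>-\<^sup>1\<close> is a contraction. This is a condition on the norm of an element of
  the closed algebra generated by \<open>a\<close>, which an embedding can transport. Squaring both sides leaves
  \<open>0 \<le> s\<^sup>2 (norm x)\<^sup>2 + 2 s Re \<langle>a x, x\<rangle>\<close>, and the second term dominates as \<open>s\<close> tends to \<open>0\<close>.\<close>

lemma accretive_iff_resolvent_bound:
  fixes a :: "'h::complex_hilbert_space \<Rightarrow>\<^sub>L 'h"
  shows "accretive a \<longleftrightarrow> (\<forall>s>0. \<forall>x. norm (blinfun_apply a x) \<le> norm (s *\<^sub>R x + a x))"
    (is "_ \<longleftrightarrow> ?R")
proof -
  have expand: "(norm (s *\<^sub>R x + a x))\<^sup>2 =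
      (norm (a x))\<^sup>2 + s * (s * (norm x)\<^sup>2 + 2 * Re (cinner (a x) x))" for s x
    unfolding norm_add_power2
    by (simp add: cinner_scaleR_left power_mult_distrib Re_cinner_commute[of x] algebra_simps)
      (simp add: power2_eq_square)
  show ?thesis
  proof
    assume "accretive a"
    show ?R
    proof (intro allI impI)
      fix s :: real and x assume "s > 0"
      moreover have "0 \<le> Re (cinner (a x) x)"
        using \<open>accretive a\<close> by (simp only: accretive_def)
      ultimately have "0 \<le> s * (s * (norm x)\<^sup>2 + 2 * Re (cinner (a x) x))"
        by (intro mult_nonneg_nonneg add_nonneg_nonneg) auto
      then have "(norm (a x))\<^sup>2 \<le> (norm (s *\<^sub>R x + a x))\<^sup>2"
        unfolding expand by linarith
      then show "norm (a x) \<le> norm (s *\<^sub>R x + a x)"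
        by (rule power2_le_imp_le) simp
    qed
  next
    assume R: ?R
    show "accretive a"
      unfolding accretive_def
    proof
      fix x
      have "0 \<le> s * (norm x)\<^sup>2 + 2 * Re (cinner (a x) x)" if "s > 0" for s
      proof -
        have "(norm (a x))\<^sup>2 \<le> (norm (s *\<^sub>R x + a x))\<^sup>2"
          using R that by (intro power_mono) auto
        with that show ?thesis by (simp add: expand zero_le_mult_iff)
      qed
      then have "\<forall>\<^sub>F s in at_right 0. 0 \<le> s * (norm x)\<^sup>2 + 2 * Re (cinner (a x) x)"
        by (simp add: eventually_at_right_less eventually_at_filter)
      moreover have "((\<lambda>s. s * (norm x)\<^sup>2 + 2 * Re (cinner (a x) x))
          \<longlongrightarrow> 0 * (norm x)\<^sup>2 + 2 * Re (cinner (a x) x)) (at_right 0)"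
        by (intro tendsto_intros)
      ultimately have "0 \<le> 0 * (norm x)\<^sup>2 + 2 * Re (cinner (a x) x)"
        by (intro tendsto_lowerbound[of _ _ "at_right 0" 0]) auto
      then show "0 \<le> Re (cinner (a x) x)" by simp
    qed
  qed
qed

text \<open>By \<open>accretive_iff_resolvent_bound\<close> it suffices that \<open>a (s + a)\<^sup>-\<^sup>1\<close> is a limit of polynomials in \<open>a\<close>
  without constant term: these lie in \<open>A\<close>, and \<open>j\<close> carries them isometrically to the same polynomials in
  \<open>j a\<close>. One expands around a large \<open>R\<close>: accretivity gives
  \<open>(norm (R - a))\<^sup>2 \<le> R\<^sup>2 + (norm a)\<^sup>2 < (R + s)\<^sup>2\<close>, so \<open>z = (R - a) / (R + s)\<close> has norm below \<open>1\<close> and the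
  partial sums \<open>y N\<close> of the Neumann series of \<open>a (s + a)\<^sup>-\<^sup>1\<close> satisfy \<open>(s + a) y N = a - a z\<^sup>N\<close>.\<close>

lemma embedding_accretive:
  fixes A :: "('h::complex_hilbert_space \<Rightarrow>\<^sub>L 'h) set"
    and B :: "('k::complex_hilbert_space \<Rightarrow>\<^sub>L 'k) set"
  assumes A: "jordan_operator_algebra A" and j: "isometric_jordan_embedding A B j"
    and a: "a \<in> A" and acc: "accretive a"
  shows "accretive (j a)"
  unfolding accretive_iff_resolvent_bound
proof (intro allI impI)
  fix s :: real and v :: 'k assume s: "s > 0"
  \<comment> \<open>With this \<open>R\<close> the inequality \<open>R\<^sup>2 + (norm a)\<^sup>2 < (R + s)\<^sup>2\<close> reduces to \<open>0 < s\<^sup>2\<close>.\<close>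
  define R where "R = (norm a)\<^sup>2 / (2 * s)"
  define q where "q = sqrt (R\<^sup>2 + (norm a)\<^sup>2) / (R + s)"
  have R: "R \<ge> 0" using s by (simp add: R_def)
  have Rs: "R + s > 0" using R s by simp
  have "R\<^sup>2 + (norm a)\<^sup>2 < (R + s)\<^sup>2"
    using s by (simp add: R_def power2_sum)
  then have "sqrt (R\<^sup>2 + (norm a)\<^sup>2) < R + s"
    using Rs by (simp add: real_less_lsqrt)
  then have q: "0 \<le> q" "q < 1"
    using Rs by (simp_all add: q_def)
  define t where "t = 1 / (R + s)"
  have t: "t > 0" "t * (R + s) = 1" using Rs by (simp_all add: t_def)
  define z where "z x = t *\<^sub>R (R *\<^sub>R x - blinfun_apply a x)" for x
  have z_norm: "norm (z x) \<le> q * norm x" for x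
  proof -
    have "(norm (R *\<^sub>R x - a x))\<^sup>2 \<le> R\<^sup>2 * (norm x)\<^sup>2 + (norm (a x))\<^sup>2"
      using acc R by (simp add: norm_power2_scaled_diff accretive_def)
    also have "\<dots> \<le> (sqrt (R\<^sup>2 + (norm a)\<^sup>2) * norm x)\<^sup>2"
      using power_mono[OF norm_blinfun[of a x], of 2] by (simp add: power_mult_distrib algebra_simps)
    finally have "norm (R *\<^sub>R x - a x) \<le> sqrt (R\<^sup>2 + (norm a)\<^sup>2) * norm x"
      by (rule power2_le_imp_le) simp
    then show ?thesis
      using t(1) Rs by (simp add: z_def q_def t_def divide_right_mono)
  qed
  have zn_norm: "norm ((z ^^ n) x) \<le> q ^ n * norm x" for n x
  proof (induction n)
    case (Suc n)
    have "norm (z ((z ^^ n) x)) \<le> q * (q ^ n * norm x)"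
      using z_norm[of "(z ^^ n) x"] Suc q(1) by (meson mult_left_mono order_trans)
    then show ?case by (simp add: mult.assoc)
  qed simp
  define u where "u = rec_nat a (\<lambda>_ w. t *\<^sub>R (R *\<^sub>R w - a \<circ>\<^sub>J w))"
  have u0: "u 0 = a" and uS: "u (Suc n) = t *\<^sub>R (R *\<^sub>R u n - a \<circ>\<^sub>J u n)" for n
    by (simp_all add: u_def)
  have uA: "u n \<in> A" for n
    by (induction n) (simp_all add: u0 uS a jordan_algebra_scaleR[OF A] jordan_algebra_diff[OF A]
        jordan_algebra_jordan_prod[OF A])
  have u_comm: "a o\<^sub>L u n = u n o\<^sub>L a" for n
  proof (induction n)
    case (Suc n)
    then show ?case
      unfolding uS by (rule compose_commute_jordan_step)
  qed (simp add: u0)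
  \<comment> \<open>The recursion uses Jordan products so that \<open>j\<close> can follow it; it computes \<open>u n = a z\<^sup>n\<close>.\<close>
  have u_apply: "blinfun_apply (u n) x = a ((z ^^ n) x)" for n x
  proof (induction n arbitrary: x)
    case (Suc n)
    have "u (Suc n) x = t *\<^sub>R (R *\<^sub>R u n x - u n (a x))"
      unfolding uS jordan_prod_commuting[OF u_comm] unfolding u_comm by (simp add: blinfun_linear)
    also have "\<dots> = u n (z x)"
      by (simp add: z_def blinfun_linear)
    also have "\<dots> = a ((z ^^ Suc n) x)"
      by (simp only: Suc funpow_Suc_right o_apply)
    finally show ?case .
  qed (simp add: u0)
  define y where "y N = t *\<^sub>R (\<Sum>n<N. u n)" for N
  have yA: "y N \<in> A" for N
    unfolding y_def using uA by (intro jordan_algebra_scaleR[OF A] jordan_algebra_sum[OF A])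
  have y_eq: "s *\<^sub>R y N + a \<circ>\<^sub>J y N = a - u N" for N
  proof (induction N)
    case (Suc N)
    have "y (Suc N) = y N + t *\<^sub>R u N" by (simp add: y_def scaleR_add_right)
    then have "s *\<^sub>R y (Suc N) + a \<circ>\<^sub>J y (Suc N)
        = (s *\<^sub>R y N + a \<circ>\<^sub>J y N) + t *\<^sub>R (s *\<^sub>R u N + a \<circ>\<^sub>J u N)"
      by (simp add: jordan_prod_def compose_linear algebra_simps)
    also have "\<dots> = a - (t * (R + s)) *\<^sub>R u N + t *\<^sub>R (s *\<^sub>R u N + a \<circ>\<^sub>J u N)"
      by (simp add: Suc t)
    also have "\<dots> = a - u (Suc N)"
      unfolding uS by (simp add: algebra_simps)
    finally show ?case .
  qed (simp add: y_def u0 jordan_prod_def)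
  \<comment> \<open>In terms of \<open>w = (v + z v + \<dots> + z\<^sup>N\<^sup>-\<^sup>1 v) / (R + s)\<close> one has \<open>y N v = a w\<close> and
    \<open>(s + a) w = v - z\<^sup>N v\<close>, so the bound is accretivity of \<open>a\<close> applied to \<open>w\<close>.\<close>
  have y_norm: "norm (y N) \<le> 1 + q ^ N" for N
  proof (rule norm_blinfun_bound)
    fix x
    define w where "w = t *\<^sub>R (\<Sum>n<N. (z ^^ n) x)"
    have "y N x = a w"
      by (simp add: y_def w_def blinfun.sum_left blinfun.sum_right blinfun_linear u_apply)
    have telescope: "(R + s) *\<^sub>R w - (R *\<^sub>R w - a w) = x - (z ^^ N) x"
    proof -
      have "z (\<Sum>n<N. (z ^^ n) x) = (\<Sum>n<N. (z ^^ Suc n) x)"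
        by (simp add: z_def blinfun.sum_right scaleR_right.sum flip: sum_subtractf)
      moreover have z_shift: "(\<Sum>n<N. (z ^^ n) x - z ((z ^^ n) x)) = x - (z ^^ N) x"
        by (induction N) simp_all
      moreover have "(R + s) *\<^sub>R w - (R *\<^sub>R w - a w) = (\<Sum>n<N. (z ^^ n) x) - z (\<Sum>n<N. (z ^^ n) x)"
        using t(2) by (simp add: w_def z_def blinfun_linear mult.commute scaleR_diff_right)
      ultimately show ?thesis
        by (simp add: sum_subtractf[symmetric] z_shift)
    qed
    have "norm (a w) \<le> norm (s *\<^sub>R w + a w)"
      using acc s by (simp add: accretive_iff_resolvent_bound)
    also have "s *\<^sub>R w + a w = x - (z ^^ N) x"
      unfolding telescope[symmetric] by (simp add: algebra_simps)
    also have "norm \<dots> \<le> norm x + q ^ N * norm x"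
      by (rule order_trans[OF norm_triangle_ineq4]) (simp add: zn_norm)
    finally show "norm (y N x) \<le> (1 + q ^ N) * norm x"
      by (simp add: \<open>y N x = a w\<close> algebra_simps)
  qed (use q in simp)
  have u_norm: "norm (u N) \<le> norm a * q ^ N" for N
  proof (rule norm_blinfun_bound)
    fix x
    show "norm (u N x) \<le> norm a * q ^ N * norm x"
      unfolding u_apply mult.assoc
      by (rule order_trans[OF norm_blinfun]) (intro mult_left_mono zn_norm norm_ge_zero)
  qed (use q in simp)
  have ju_comm: "j a o\<^sub>L j (u n) = j (u n) o\<^sub>L j a" for n
  proof (induction n)
    case (Suc n)
    have "j (u (Suc n)) = t *\<^sub>R (R *\<^sub>R j (u n) - j a \<circ>\<^sub>J j (u n))"
      by (simp add: uS embedding_scaleR[OF A j] embedding_diff[OF A j] embedding_jordan_prod[OF A j]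
          uA a jordan_algebra_scaleR[OF A] jordan_algebra_diff[OF A] jordan_algebra_jordan_prod[OF A])
    then show ?case
      using compose_commute_jordan_step[OF Suc] by simp
  qed (simp add: u0)
  have jy_comm: "j a o\<^sub>L j (y n) = j (y n) o\<^sub>L j a" for n
  proof (induction n)
    case 0
    have "j 0 = 0"
      using embedding_diff[OF A j a a] by simp
    then show ?case by (simp add: y_def)
  next
    case (Suc n)
    have "y (Suc n) = y n + t *\<^sub>R u n" by (simp add: y_def scaleR_add_right)
    then have "j (y (Suc n)) = j (y n) + t *\<^sub>R j (u n)"
      by (simp add: embedding_add[OF A j] embedding_scaleR[OF A j] yA uA jordan_algebra_scaleR[OF A])
    with Suc ju_comm show ?case
      by (simp add: compose_linear)
  qed
  have "norm (j a v) \<le> (1 + q ^ N) * norm (s *\<^sub>R v + j a v) + norm a * q ^ N * norm v" for N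
  proof -
    have "s *\<^sub>R j (y N) + j a \<circ>\<^sub>J j (y N) = j (s *\<^sub>R y N + a \<circ>\<^sub>J y N)"
      by (simp add: embedding_add[OF A j] embedding_scaleR[OF A j] embedding_jordan_prod[OF A j]
          yA a jordan_algebra_scaleR[OF A] jordan_algebra_jordan_prod[OF A])
    also have "\<dots> = j a - j (u N)"
      by (simp add: y_eq embedding_diff[OF A j] a uA)
    finally have "s *\<^sub>R j (y N) + (j (y N) o\<^sub>L j a) = j a - j (u N)"
      unfolding jordan_prod_commuting[OF jy_comm] unfolding jy_comm .
    then have "j a v = s *\<^sub>R j (y N) v + j (y N) (j a v) + j (u N) v"
      by (metis (no_types, lifting) blinfun.add_left blinfun.scaleR_left
          blinfun_apply_blinfun_compose diff_add_cancel)
    then have "norm (j a v) = norm (j (y N) (s *\<^sub>R v + j a v) + j (u N) v)"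
      by (simp add: blinfun_linear)
    also have "\<dots> \<le> norm (j (y N)) * norm (s *\<^sub>R v + j a v) + norm (j (u N)) * norm v"
      by (intro norm_triangle_le add_mono norm_blinfun)
    also have "\<dots> \<le> (1 + q ^ N) * norm (s *\<^sub>R v + j a v) + norm a * q ^ N * norm v"
      using y_norm u_norm
      by (intro add_mono mult_right_mono) (simp_all add: embedding_norm[OF A j] yA uA)
    finally show ?thesis .
  qed
  moreover have "(\<lambda>N. (1 + q ^ N) * norm (s *\<^sub>R v + j a v) + norm a * q ^ N * norm v)
      \<longlonglongrightarrow> (1 + 0) * norm (s *\<^sub>R v + j a v) + norm a * 0 * norm v"
    using q by (intro tendsto_intros LIMSEQ_realpow_zero) auto
  ultimately have "norm (j a v) \<le> (1 + 0) * norm (s *\<^sub>R v + j a v) + norm a * 0 * norm v"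
    by (intro LIMSEQ_le_const) auto
  then show "norm (j a v) \<le> norm (s *\<^sub>R v + j a v)" by simp
qed

section \<open>Approximate identities\<close>

definition unit_defect ::
  "('h::complex_hilbert_space \<Rightarrow>\<^sub>L 'h) \<Rightarrow> ('h \<Rightarrow>\<^sub>L 'h) \<Rightarrow> real" where
  "unit_defect e a = max (norm ((e o\<^sub>L a) - a)) (norm ((a o\<^sub>L e) - a))"

text \<open>If \<open>f\<close> and \<open>g\<close> anticommute with \<open>a\<close>, then \<open>g f + f g\<close> commutes with \<open>a\<close>; if this sum is \<open>2 g\<close>, then
  \<open>g\<close> both commutes and anticommutes with \<open>a\<close>, so \<open>g a = 0\<close>. The lemma is the quantitative version.\<close>

lemma anticommuting_bound:
  assumes f: "norm f \<le> 2" and g: "norm g \<le> 2"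
    and fa: "norm ((f o\<^sub>L a) + (a o\<^sub>L f)) \<le> \<epsilon>" and ga: "norm ((g o\<^sub>L a) + (a o\<^sub>L g)) \<le> \<epsilon>"
    and h: "norm ((g o\<^sub>L f) + (f o\<^sub>L g) - 2 *\<^sub>R g) \<le> \<delta>"
  shows "4 * norm (g o\<^sub>L a) \<le> 10 * \<epsilon> + 2 * \<delta> * norm a"
proof -
  define rf where "rf = (f o\<^sub>L a) + (a o\<^sub>L f)"
  define rg where "rg = (g o\<^sub>L a) + (a o\<^sub>L g)"
  define h where "h = (g o\<^sub>L f) + (f o\<^sub>L g) - 2 *\<^sub>R g"
  have "4 *\<^sub>R (g o\<^sub>L a) = 2 *\<^sub>R rg + ((g o\<^sub>L rf) - (rg o\<^sub>L f)) + ((f o\<^sub>L rg) - (rf o\<^sub>L g))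
      + ((a o\<^sub>L h) - (h o\<^sub>L a))"
  proof (rule blinfun_eqI)
    fix x
    have four: "4 *\<^sub>R y = y + y + (y + y)" for y :: 'a
    proof -
      have "4 *\<^sub>R y = 2 *\<^sub>R (2 *\<^sub>R y)" by simp
      then show ?thesis by (simp only: scaleR_2)
    qed
    show "(4 *\<^sub>R (g o\<^sub>L a)) x = (2 *\<^sub>R rg + ((g o\<^sub>L rf) - (rg o\<^sub>L f)) + ((f o\<^sub>L rg) - (rf o\<^sub>L g))
      + ((a o\<^sub>L h) - (h o\<^sub>L a))) x"
      unfolding rf_def rg_def h_def
      by (simp add: blinfun_linear four scaleR_2 algebra_simps)
  qed
  then have "4 * norm (g o\<^sub>L a) = norm (2 *\<^sub>R rg + ((g o\<^sub>L rf) - (rg o\<^sub>L f)) + ((f o\<^sub>L rg) - (rf o\<^sub>L g))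
      + ((a o\<^sub>L h) - (h o\<^sub>L a)))"
    by (metis abs_numeral norm_scaleR)
  also have "\<dots> \<le> 2 * norm rg + (norm (g o\<^sub>L rf) + norm (rg o\<^sub>L f)) + (norm (f o\<^sub>L rg) + norm (rf o\<^sub>L g))
      + (norm (a o\<^sub>L h) + norm (h o\<^sub>L a))"
    by (intro norm_triangle_le add_mono norm_triangle_ineq4) simp_all
  also have "\<dots> \<le> 2 * \<epsilon> + (2 * \<epsilon> + \<epsilon> * 2) + (2 * \<epsilon> + \<epsilon> * 2) + (norm a * \<delta> + \<delta> * norm a)"
    using assms unfolding rf_def[symmetric] rg_def[symmetric] h_def[symmetric]
    by (intro add_mono norm_compose_le mult_left_mono) auto
  finally show ?thesis by (simp add: mult_ac)
qed

lemma norm_id_diff_le: "norm e \<le> 1 \<Longrightarrow> norm (id_blinfun - e) \<le> 2"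
  using norm_triangle_ineq4[of id_blinfun e] norm_blinfun_id_le[where 'a='a] by force

text \<open>Put \<open>f = 1 - d\<close> and \<open>g = 1 - e\<close> for members \<open>d\<close>, \<open>e\<close> of the net. That \<open>d\<close> and \<open>e\<close> are almost Jordan
  identities for \<open>a\<close> means that \<open>f\<close> and \<open>g\<close> almost anticommute with \<open>a\<close>, and that \<open>e\<close> is one for \<open>d\<close>
  means that \<open>g f + f g\<close> is almost \<open>2 g\<close>. So \<open>anticommuting_bound\<close> applies once \<open>e\<close> lies far beyond \<open>d\<close>.\<close>

lemma approximate_identity_two_sided:
  fixes A :: "('h::complex_hilbert_space \<Rightarrow>\<^sub>L 'h) set"
  assumes F: "F \<noteq> bot" "\<forall>\<^sub>F e in F. e \<in> A \<and> norm e \<le> 1"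
    and lim: "\<And>a. a \<in> A \<Longrightarrow> ((\<lambda>e. e \<circ>\<^sub>J a) \<longlongrightarrow> a) F"
    and a: "a \<in> A" and \<eta>: "\<eta> > 0"
  shows "\<forall>\<^sub>F e in F. unit_defect e a < \<eta>"
proof -
  define \<epsilon> where "\<epsilon> = \<eta> / (8 + norm a)"
  have \<epsilon>: "\<epsilon> > 0" using \<eta> by (simp add: \<epsilon>_def add_pos_nonneg)
  have close: "\<forall>\<^sub>F e in F. norm (e \<circ>\<^sub>J b - b) < \<epsilon>" if "b \<in> A" for b
    using tendstoD[OF lim[OF that] \<epsilon>] by (simp add: dist_norm)
  obtain d where d: "d \<in> A" "norm d \<le> 1" "norm (d \<circ>\<^sub>J a - a) < \<epsilon>"
    using eventually_happens[OF eventually_conj[OF F(2) close[OF a]]] F(1) by auto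
  have anti: "((id_blinfun - e) o\<^sub>L a) + (a o\<^sub>L (id_blinfun - e)) = (-2) *\<^sub>R (e \<circ>\<^sub>J a - a)"
    for e a :: "'h \<Rightarrow>\<^sub>L 'h"
    unfolding jordan_prod_def
    by (rule blinfun_eqI) (simp add: blinfun_linear algebra_simps scaleR_2)
  have dom: "((id_blinfun - e) o\<^sub>L (id_blinfun - d)) + ((id_blinfun - d) o\<^sub>L (id_blinfun - e))
      - 2 *\<^sub>R (id_blinfun - e) = 2 *\<^sub>R (e \<circ>\<^sub>J d - d)" for e d :: "'h \<Rightarrow>\<^sub>L 'h"
    unfolding jordan_prod_def
    by (rule blinfun_eqI) (simp add: blinfun_linear algebra_simps scaleR_2)
  from F(2) close[OF a] close[OF d(1)] show ?thesis
  proof eventually_elim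
    case (elim e)
    define g where "g = id_blinfun - e"
    have ga: "norm ((g o\<^sub>L a) + (a o\<^sub>L g)) \<le> 2 * \<epsilon>"
      unfolding g_def anti using elim by simp
    have "4 * norm (g o\<^sub>L a) \<le> 10 * (2 * \<epsilon>) + 2 * (2 * \<epsilon>) * norm a"
    proof (rule anticommuting_bound[OF norm_id_diff_le[OF d(2)]])
      show "norm g \<le> 2" using elim by (simp add: g_def norm_id_diff_le)
      show "norm (((id_blinfun - d) o\<^sub>L a) + (a o\<^sub>L (id_blinfun - d))) \<le> 2 * \<epsilon>"
        unfolding anti using d by simp
      show "norm ((g o\<^sub>L (id_blinfun - d)) + ((id_blinfun - d) o\<^sub>L g) - 2 *\<^sub>R g) \<le> 2 * \<epsilon>"
        unfolding g_def dom using elim by simp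
    qed (rule ga)
    then have left: "norm (g o\<^sub>L a) \<le> (5 + norm a) * \<epsilon>"
      by (simp add: algebra_simps)
    have "norm (a o\<^sub>L g) \<le> norm ((g o\<^sub>L a) + (a o\<^sub>L g)) + norm (g o\<^sub>L a)"
      using norm_triangle_ineq4[of "(g o\<^sub>L a) + (a o\<^sub>L g)" "g o\<^sub>L a"] by simp
    with ga left have right: "norm (a o\<^sub>L g) \<le> (7 + norm a) * \<epsilon>"
      by (simp add: algebra_simps)
    have "(e o\<^sub>L a) - a = - (g o\<^sub>L a)" "(a o\<^sub>L e) - a = - (a o\<^sub>L g)"
      by (auto intro!: blinfun_eqI simp: g_def blinfun_linear)
    then have "unit_defect e a \<le> (7 + norm a) * \<epsilon>"
      using left right \<epsilon> by (simp add: unit_defect_def) (simp add: algebra_simps)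
    also have "\<dots> < (8 + norm a) * \<epsilon>" using \<epsilon> by simp
    also have "\<dots> = \<eta>"
      using norm_ge_zero[of a] by (simp add: \<epsilon>_def del: norm_ge_zero)
    finally show ?case .
  qed
qed

lemma two_sided_unit_exists:
  assumes "approximately_unital A" "finite X" "X \<subseteq> A" "\<eta> > 0"
  shows "\<exists>e\<in>A. norm e \<le> 1 \<and> (\<forall>x\<in>X. unit_defect e x < \<eta>)"
proof -
  obtain F where F: "F \<noteq> bot" "\<forall>\<^sub>F e in F. e \<in> A \<and> norm e \<le> 1"
      "\<And>a. a \<in> A \<Longrightarrow> ((\<lambda>e. e \<circ>\<^sub>J a) \<longlongrightarrow> a) F"
    using assms(1) by (auto simp: approximately_unital_def)
  have "\<forall>\<^sub>F e in F. \<forall>x\<in>X. unit_defect e x < \<eta>"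
    using approximate_identity_two_sided[OF F _ assms(4)] assms(2,3)
    by (simp add: eventually_ball_finite subset_iff)
  from eventually_happens[OF eventually_conj[OF F(2) this]] F(1) show ?thesis by blast
qed

text \<open>A vector fixed by a contraction is fixed by its adjoint, the equality case of the Cauchy-Schwarz
  inequality; here with an error term. The number \<open>c\<close> bounds the length of the vector.\<close>

lemma contraction_fixes_adjoint_fixes:
  fixes y :: "'h::complex_hilbert_space"
  assumes adj: "\<And>u v. cinner (blinfun_apply g u) v = cinner u (blinfun_apply h v)" and h: "norm h \<le> 1"
    and y: "norm y \<le> c" and gy: "norm (g y - y) \<le> \<epsilon> * c" and c: "c \<ge> 0"
  shows "norm (h y - y) \<le> sqrt (2 * \<epsilon>) * c"
proof -
  have "(norm (h y - y))\<^sup>2 = (norm (h y))\<^sup>2 - 2 * Re (cinner (g y) y) + (norm y)\<^sup>2"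
    by (simp add: norm_diff_power2 adj Re_cinner_commute[of y])
  also have "\<dots> \<le> 2 * (norm y)\<^sup>2 - 2 * Re (cinner (g y) y)"
    using power_mono[OF norm_contraction[OF h, of y], of 2] by simp
  also have "\<dots> = 2 * Re (cinner (y - g y) y)"
    by (simp add: cinner_diff_left Re_cinner_self)
  also have "\<dots> \<le> 2 * (norm (y - g y) * norm y)"
    by (simp add: Re_cinner_le)
  also have "\<dots> \<le> 2 * (\<epsilon> * c * c)"
    using y gy c order_trans[OF norm_ge_zero gy] by (intro mult_left_mono mult_mono) (auto simp: norm_minus_commute)
  finally have sq: "(norm (h y - y))\<^sup>2 \<le> 2 * \<epsilon> * c\<^sup>2" by (simp add: power2_eq_square mult_ac)
  have "sqrt ((norm (h y - y))\<^sup>2) \<le> sqrt (2 * \<epsilon> * c\<^sup>2)"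
    using sq by (rule real_sqrt_le_mono)
  then show ?thesis using c by (simp add: real_sqrt_mult)
qed

text \<open>If \<open>d\<close> acts as an identity on \<open>e\<close> from both sides, then \<open>d - d*\<close> annihilates the ranges of \<open>e\<close> and
  \<open>e*\<close> by \<open>contraction_fixes_adjoint_fixes\<close>. The skew parts of \<open>e\<close> and \<open>d\<close> are then orthogonal, so their
  sum has norm about \<open>sqrt 2 * \<kappa>\<close> instead of \<open>2 * \<kappa>\<close>; the bound \<open>3/2 * \<kappa>\<close> leaves room for the errors.\<close>

lemma average_selfadjoint_defect:
  fixes e d :: "'h::complex_hilbert_space \<Rightarrow>\<^sub>L 'h"
  assumes ops: "e \<in> bounded_operators" "d \<in> bounded_operators"
    and contr: "norm e \<le> 1" "norm d \<le> 1"
    and \<kappa>: "norm (e - cadjoint e) \<le> \<kappa>" "norm (d - cadjoint d) \<le> \<kappa>"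
    and defect: "unit_defect d e \<le> \<epsilon>" and \<epsilon>: "\<epsilon> \<ge> 0" and small: "8 * (\<epsilon> + sqrt (2 * \<epsilon>)) \<le> \<kappa>\<^sup>2 / 2"
  shows "norm ((e + d) - (cadjoint e + cadjoint d)) \<le> 3/2 * \<kappa>"
proof (rule norm_blinfun_bound)
  show "0 \<le> 3/2 * \<kappa>" using order_trans[OF norm_ge_zero \<kappa>(1)] by simp
  fix x
  define e' where "e' = cadjoint e"
  define d' where "d' = cadjoint d"
  have adj: "cinner (e u) v = cinner u (e' v)" "cinner (d u) v = cinner u (d' v)"
    "cinner (e' u) v = cinner u (e v)" "cinner (d' u) v = cinner u (d v)" for u v
    by (simp_all add: e'_def d'_def cinner_cadjoint cinner_cadjoint_left ops)
  have contr': "norm e' \<le> 1" "norm d' \<le> 1"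
    using norm_cadjoint_le[OF ops(1)] norm_cadjoint_le[OF ops(2)] contr by (simp_all add: e'_def d'_def)
  define s where "s = \<epsilon> + sqrt (2 * \<epsilon>)"
  have de: "norm (d (e x) - e x) \<le> \<epsilon> * norm x"
    using norm_blinfun_le[of "(d o\<^sub>L e) - e" \<epsilon> x] defect by (simp add: unit_defect_def blinfun_linear)
  have de': "norm (d' (e' x) - e' x) \<le> \<epsilon> * norm x"
  proof -
    let ?v = "d' (e' x) - e' x"
    have "(norm ?v)\<^sup>2 = Re (cinner (((e o\<^sub>L d) - e) ?v) x)"
      by (simp only: Re_cinner_self[symmetric])
        (simp add: blinfun_linear cinner_diff_right cinner_diff_left adj)
    also have "\<dots> \<le> (\<epsilon> * norm ?v) * norm x"
      using defect by (intro order_trans[OF Re_cinner_le] mult_right_mono norm_blinfun_le)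
        (simp_all add: unit_defect_def)
    finally have "norm ?v * norm ?v \<le> norm ?v * (\<epsilon> * norm x)"
      by (simp add: power2_eq_square mult_ac)
    then show ?thesis
      using \<epsilon> by (cases "norm ?v = 0") (simp_all add: mult_le_cancel_left)
  qed
  have k1: "norm (d (e x) - d' (e x)) \<le> s * norm x"
  proof -
    have "norm (d' (e x) - e x) \<le> sqrt (2 * \<epsilon>) * norm x"
      using contraction_fixes_adjoint_fixes[OF adj(2) contr'(2) norm_contraction[OF contr(1)] de] by simp
    then show ?thesis
      using de norm_triangle_ineq4[of "d (e x) - e x" "d' (e x) - e x"] by (simp add: s_def algebra_simps)
  qed
  have k2: "norm (d (e' x) - d' (e' x)) \<le> s * norm x"
  proof -
    have "norm (d (e' x) - e' x) \<le> sqrt (2 * \<epsilon>) * norm x"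
      using contraction_fixes_adjoint_fixes[OF adj(4) contr(2) norm_contraction[OF contr'(1)] de'] by simp
    then show ?thesis
      using de' norm_triangle_ineq4[of "d (e' x) - e' x" "d' (e' x) - e' x"]
      by (simp add: s_def algebra_simps)
  qed
  define p where "p = e x - e' x"
  define q where "q = d x - d' x"
  have "Re (cinner p q) = Re (cinner (d' p - d p) x)"
    by (simp add: q_def cinner_diff_left cinner_diff_right adj)
  also have "\<dots> \<le> norm (d' p - d p) * norm x" by (rule Re_cinner_le)
  also have "\<dots> \<le> (2 * s * norm x) * norm x"
  proof (rule mult_right_mono)
    have "d' p - d p = (d (e' x) - d' (e' x)) - (d (e x) - d' (e x))"
      by (simp add: p_def blinfun_linear)
    then show "norm (d' p - d p) \<le> 2 * s * norm x"
      using norm_triangle_ineq4[of "d (e' x) - d' (e' x)" "d (e x) - d' (e x)"] k1 k2 by simp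
  qed simp
  finally have cross: "2 * Re (cinner p q) \<le> (4 * s) * (norm x)\<^sup>2"
    by (simp add: power2_eq_square mult_ac)
  have pq: "(norm p)\<^sup>2 \<le> \<kappa>\<^sup>2 * (norm x)\<^sup>2" "(norm q)\<^sup>2 \<le> \<kappa>\<^sup>2 * (norm x)\<^sup>2"
    using power_mono[OF norm_blinfun_le[OF \<kappa>(1), of x], of 2] power_mono[OF norm_blinfun_le[OF \<kappa>(2), of x], of 2]
    by (simp_all add: p_def q_def e'_def d'_def blinfun_linear power_mult_distrib)
  have "(norm (p + q))\<^sup>2 \<le> (2 * \<kappa>\<^sup>2 + 4 * s) * (norm x)\<^sup>2"
    using pq cross by (simp add: norm_add_power2 algebra_simps)
  also have "\<dots> \<le> (9/4 * \<kappa>\<^sup>2) * (norm x)\<^sup>2"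
    using small by (intro mult_right_mono) (simp_all add: s_def)
  also have "\<dots> = (3/2 * \<kappa> * norm x)\<^sup>2"
    by (simp add: power2_eq_square)
  finally have "norm (p + q) \<le> 3/2 * \<kappa> * norm x"
    by (rule power2_le_imp_le) (use \<open>0 \<le> 3/2 * \<kappa>\<close> in simp)
  then show "norm (((e + d) - (cadjoint e + cadjoint d)) x) \<le> 3/2 * \<kappa> * norm x"
    by (simp add: p_def q_def e'_def d'_def blinfun_linear algebra_simps)
qed

lemma unit_defect_average:
  "unit_defect ((1/2) *\<^sub>R (e + d)) x \<le> (unit_defect e x + unit_defect d x) / 2"
proof -
  have "(((1/2) *\<^sub>R (e + d)) o\<^sub>L x) - x = (1/2) *\<^sub>R (((e o\<^sub>L x) - x) + ((d o\<^sub>L x) - x))"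
    "(x o\<^sub>L ((1/2) *\<^sub>R (e + d))) - x = (1/2) *\<^sub>R (((x o\<^sub>L e) - x) + ((x o\<^sub>L d) - x))"
    by (auto intro!: blinfun_eqI simp: blinfun_linear algebra_simps) (simp_all flip: scaleR_add_right)
  then show ?thesis
    using norm_triangle_ineq[of "(e o\<^sub>L x) - x" "(d o\<^sub>L x) - x"]
      norm_triangle_ineq[of "(x o\<^sub>L e) - x" "(x o\<^sub>L d) - x"]
    unfolding unit_defect_def by (simp only: norm_scaleR) (simp add: max_def field_simps)
qed

text \<open>Averaging \<open>e\<close> with a \<open>d\<close> that is almost an identity for \<open>e\<close> keeps the other properties and
  multiplies the selfadjointness defect by \<open>3/4\<close> (\<open>average_selfadjoint_defect\<close>). Finite sets of elements
  are needed because \<open>d\<close> has to respect \<open>e\<close> in addition to \<open>X\<close>.\<close>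

lemma nearly_selfadjoint_unit_power:
  assumes A: "jordan_operator_algebra A" "approximately_unital A"
    and X: "finite X" "X \<subseteq> A" and \<eta>: "\<eta> > 0"
  shows "\<exists>e\<in>A. norm e \<le> 1 \<and> norm (e - cadjoint e) \<le> 2 * (3/4) ^ n \<and> (\<forall>x\<in>X. unit_defect e x < \<eta>)"
  using X \<eta>
proof (induction n arbitrary: X \<eta>)
  case 0
  then obtain e where e: "e \<in> A" "norm e \<le> 1" "\<forall>x\<in>X. unit_defect e x < \<eta>"
    using two_sided_unit_exists[OF A(2)] by blast
  have "norm (e - cadjoint e) \<le> 2"
    using norm_triangle_ineq4[of e "cadjoint e"] e(2)
      norm_cadjoint_le[OF jordan_algebra_bounded[OF A(1) e(1)]] by simp
  with e show ?case by auto
next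
  case (Suc n)
  define \<kappa> :: real where "\<kappa> = 2 * (3/4) ^ n"
  have \<kappa>: "0 < \<kappa>" "\<kappa> \<le> 2"
    by (simp_all add: \<kappa>_def power_le_one)
  \<comment> \<open>Chosen so that \<open>sqrt (2 * \<epsilon>) = \<kappa>\<^sup>2 / 64\<close>, the larger part of the error in \<open>average_selfadjoint_defect\<close>.\<close>
  define \<epsilon> where "\<epsilon> = (\<kappa>\<^sup>2 / 64)\<^sup>2 / 2"
  have k2: "0 < \<kappa>\<^sup>2" "\<kappa>\<^sup>2 \<le> 4"
    using \<kappa> power_mono[of \<kappa> 2 2] by simp_all
  have \<epsilon>: "\<epsilon> > 0" using \<kappa> by (simp add: \<epsilon>_def)
  have root: "sqrt (2 * \<epsilon>) = \<kappa>\<^sup>2 / 64" by (simp add: \<epsilon>_def)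
  have "\<epsilon> \<le> \<kappa>\<^sup>2 / 64"
  proof -
    have "\<epsilon> = (\<kappa>\<^sup>2 / 64) * (\<kappa>\<^sup>2 / 128)" by (simp add: \<epsilon>_def power2_eq_square)
    also have "\<dots> \<le> (\<kappa>\<^sup>2 / 64) * 1" using k2 by (intro mult_left_mono) auto
    finally show ?thesis by simp
  qed
  moreover have "8 * (t + K / 64) \<le> K / 2" if "t \<le> K / 64" "0 < K" for t K :: real
    using that by (simp add: field_simps)
  ultimately have small: "8 * (\<epsilon> + sqrt (2 * \<epsilon>)) \<le> \<kappa>\<^sup>2 / 2"
    unfolding root using k2(1) by blast
  obtain e where e: "e \<in> A" "norm e \<le> 1" "norm (e - cadjoint e) \<le> \<kappa>" "\<forall>x\<in>X. unit_defect e x < \<eta>"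
    using Suc.IH[OF Suc.prems] unfolding \<kappa>_def by blast
  obtain d where d: "d \<in> A" "norm d \<le> 1" "norm (d - cadjoint d) \<le> \<kappa>"
      "\<forall>x\<in>insert e X. unit_defect d x < min \<eta> \<epsilon>"
    using Suc.IH[of "insert e X" "min \<eta> \<epsilon>"] Suc.prems e(1) \<epsilon> unfolding \<kappa>_def by auto
  define m where "m = (1/2) *\<^sub>R (e + d)"
  note ops = jordan_algebra_bounded[OF A(1)]
  have mA: "m \<in> A"
    unfolding m_def by (intro jordan_algebra_scaleR[OF A(1)] jordan_algebra_add[OF A(1)] e d)
  moreover have "norm m \<le> 1"
    using norm_triangle_ineq[of e d] e(2) d(2) by (simp add: m_def)
  moreover have "norm (m - cadjoint m) \<le> 2 * (3/4) ^ Suc n"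
  proof -
    have "m - cadjoint m = (1/2) *\<^sub>R ((e + d) - (cadjoint e + cadjoint d))"
      using cadjoint_half_sum[OF ops[OF e(1)] ops[OF d(1)]] ops[OF mA]
      by (simp only: m_def scaleR_diff_right)
    moreover have "norm ((e + d) - (cadjoint e + cadjoint d)) \<le> 3/2 * \<kappa>"
      using e d \<epsilon> small
      by (intro average_selfadjoint_defect[where \<epsilon> = \<epsilon>] ops) (auto intro: less_imp_le)
    ultimately show ?thesis by (simp add: \<kappa>_def)
  qed
  moreover have "unit_defect m x < \<eta>" if "x \<in> X" for x
    using unit_defect_average[of e d x] e(4) d(4) that unfolding m_def by fastforce
  ultimately show ?case by blast
qed

lemma nearly_selfadjoint_unit:
  assumes A: "jordan_operator_algebra A" "approximately_unital A" and a: "a \<in> A" and \<eta>: "\<eta> > 0"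
  obtains e where "e \<in> A" "norm e \<le> 1" "norm (e - cadjoint e) \<le> \<eta>" "unit_defect e a \<le> \<eta>"
proof -
  obtain n where "(3/4) ^ n < \<eta> / 2"
    using real_arch_pow_inv[of "\<eta> / 2" "3/4"] \<eta> by auto
  with nearly_selfadjoint_unit_power[OF A, of "{a}" \<eta> n] a \<eta> that show ?thesis
    by (fastforce intro: less_imp_le)
qed

section \<open>Dominating elements of small norm\<close>

text \<open>If \<open>e\<close> is almost selfadjoint and almost an identity for \<open>a\<close>, then \<open>a\<close> is close to \<open>e a e\<close> and hence to
  \<open>e* a e\<close>, whose real part is at least \<open>- r e* e\<close>, and \<open>e* e\<close> is close to \<open>e\<^sup>2\<close>. So adding \<open>r e\<^sup>2\<close> leaves
  only a small negative part.\<close>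

lemma accretive_correction_step:
  fixes A :: "('h::complex_hilbert_space \<Rightarrow>\<^sub>L 'h) set"
  assumes A: "jordan_operator_algebra A" "approximately_unital A" and a: "a \<in> A" and r: "0 \<le> r"
    and low: "\<And>x. - r * (norm x)\<^sup>2 \<le> Re (cinner (blinfun_apply a x) x)" and r': "r' > 0"
  obtains e where "e \<in> A" "norm e \<le> 1"
    "\<And>x. - r' * (norm x)\<^sup>2 \<le> Re (cinner ((a + r *\<^sub>R (e o\<^sub>L e)) x) x)"
proof -
  \<comment> \<open>The errors below add up to \<open>(2 + norm a + r) * \<eta>\<close>.\<close>
  define \<eta> where "\<eta> = r' / (2 + norm a + r)"
  have pos: "2 + norm a + r > 0" using r by (simp add: add_pos_nonneg)
  have \<eta>: "\<eta> > 0" using r' pos by (simp add: \<eta>_def)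
  obtain e where e: "e \<in> A" "norm e \<le> 1" "norm (e - cadjoint e) \<le> \<eta>" "unit_defect e a \<le> \<eta>"
    using nearly_selfadjoint_unit[OF A a \<eta>] .
  have adj: "cinner (e u) v = cinner u (cadjoint e v)" for u v
    using cinner_cadjoint jordan_algebra_bounded[OF A(1) e(1)] by blast
  have "- r' * (norm x)\<^sup>2 \<le> Re (cinner ((a + r *\<^sub>R (e o\<^sub>L e)) x) x)" for x
  proof -
    define k where "k = e x - cadjoint e x"
    define y where "y = e x"
    have k: "norm k \<le> \<eta> * norm x"
      using norm_blinfun_le[OF e(3), of x] by (simp add: k_def blinfun_linear)
    have y: "norm y \<le> norm x" using norm_contraction[OF e(2)] by (simp add: y_def)
    have bound: "Re (cinner u v) \<ge> - (c * d)" if "norm u \<le> c" "norm v \<le> d" for u v :: 'h and c d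
    proof -
      have "\<bar>Re (cinner u v)\<bar> \<le> norm u * norm v" by (rule abs_Re_cinner_le)
      also have "\<dots> \<le> c * d" using that by (intro mult_mono) (auto intro: order_trans[OF norm_ge_zero])
      finally show ?thesis by simp
    qed
    define w where "w = a x - e (a y)"
    have "norm w \<le> 2 * \<eta> * norm x"
    proof -
      have "w = - (((e o\<^sub>L a) - a) y) - ((a o\<^sub>L e) - a) x"
        by (simp add: w_def y_def blinfun_linear)
      moreover have "norm ((((e o\<^sub>L a) - a)) y) \<le> \<eta> * norm x"
        using e(4) by (intro order_trans[OF norm_blinfun_le mult_left_mono[OF y]])
          (use \<eta> in \<open>auto simp: unit_defect_def\<close>)
      moreover have "norm (((a o\<^sub>L e) - a) x) \<le> \<eta> * norm x"
        using e(4) by (intro norm_blinfun_le) (auto simp: unit_defect_def)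
      ultimately show ?thesis
        using norm_triangle_ineq4[of "- (((e o\<^sub>L a) - a) y)" "((a o\<^sub>L e) - a) x"] by simp
    qed
    then have 1: "Re (cinner w x) \<ge> - (2 * \<eta> * norm x * norm x)"
      by (rule bound) simp
    have 2: "Re (cinner (a y) (- k)) \<ge> - (norm a * norm x * (\<eta> * norm x))"
      by (rule bound) (use k y in \<open>auto intro!: order_trans[OF norm_blinfun] mult_left_mono\<close>)
    have 3: "Re (cinner y (- k)) \<ge> - (norm x * (\<eta> * norm x))"
      by (rule bound) (use k y in auto)
    have ax: "Re (cinner (a x) x) = Re (cinner w x) + Re (cinner (a y) y) + Re (cinner (a y) (- k))"
    proof -
      have "cinner (a x) x = cinner w x + cinner (a y) (cadjoint e x)"
        by (simp add: w_def cinner_diff_left adj)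
      also have "cadjoint e x = y + (- k)" by (simp add: k_def y_def)
      finally show ?thesis by (simp only: cinner_add_right plus_complex.simps)
    qed
    have ex: "Re (cinner (e (e x)) x) = (norm y)\<^sup>2 + Re (cinner y (- k))"
    proof -
      have "cinner (e (e x)) x = cinner y (cadjoint e x)"
        by (simp add: adj y_def)
      also have "cadjoint e x = y + (- k)" by (simp add: k_def y_def)
      finally show ?thesis by (simp only: cinner_add_right plus_complex.simps Re_cinner_self)
    qed
    have "Re (cinner ((a + r *\<^sub>R (e o\<^sub>L e)) x) x) = Re (cinner (a x) x) + r * Re (cinner (e (e x)) x)"
      by (simp add: blinfun_linear cinner_add_left cinner_scaleR_left)
    also have "\<dots> \<ge> - (2 * \<eta> * norm x * norm x) - (norm a * norm x * (\<eta> * norm x))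
        - r * (norm x * (\<eta> * norm x))"
      using 1 2 mult_left_mono[OF 3 r] low[of y] by (simp add: ax ex distrib_left)
    also have "- (2 * \<eta> * norm x * norm x) - (norm a * norm x * (\<eta> * norm x))
        - r * (norm x * (\<eta> * norm x)) = - ((2 + norm a + r) * \<eta>) * (norm x)\<^sup>2"
      by (simp add: power2_eq_square algebra_simps)
    also have "(2 + norm a + r) * \<eta> = r'" using pos by (simp add: \<eta>_def)
    finally show ?thesis by simp
  qed
  with e that show ?thesis by blast
qed

text \<open>Iterates \<open>accretive_correction_step\<close>: the first correction has norm at most \<open>r\<close>, and the tolerances
  \<open>\<delta>/2, \<delta>/4, \<dots>\<close> that are allowed to remain after each step bound the norms of the later corrections.\<close>

lemma accretive_dominating_element:
  fixes A :: "('h::complex_hilbert_space \<Rightarrow>\<^sub>L 'h) set"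
  assumes A: "jordan_operator_algebra A" "approximately_unital A" and a: "a \<in> A" and r: "0 \<le> r"
    and low: "\<And>x. - r * (norm x)\<^sup>2 \<le> Re (cinner (blinfun_apply a x) x)" and \<delta>: "\<delta> > 0"
  obtains d where "d \<in> A" "norm d \<le> r + \<delta>" "accretive (a + d)"
proof -
  define \<rho> where "\<rho> n = (if n = 0 then r else \<delta> / 2 ^ n)" for n
  define ok where "ok n d \<longleftrightarrow>
    d \<in> A \<and> (\<forall>x. - \<rho> n * (norm x)\<^sup>2 \<le> Re (cinner (blinfun_apply (a + d) x) x)) \<and> (n = 0 \<longrightarrow> d = 0)" for n d
  have \<rho>: "\<rho> n \<ge> 0" "\<rho> (Suc n) > 0" for n using r \<delta> by (simp_all add: \<rho>_def)
  have "ok 0 0" using low by (simp add: ok_def \<rho>_def jordan_algebra_zero[OF A(1)])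
  moreover have "\<exists>d'. ok (Suc n) d' \<and> norm (d' - d) \<le> \<rho> n" if "ok n d" for n d
  proof -
    have d: "d \<in> A" and b: "- \<rho> n * (norm x)\<^sup>2 \<le> Re (cinner (blinfun_apply (a + d) x) x)" for x
      using that by (auto simp: ok_def)
    obtain e where e: "e \<in> A" "norm e \<le> 1"
      "\<And>x. - \<rho> (Suc n) * (norm x)\<^sup>2 \<le> Re (cinner (((a + d) + \<rho> n *\<^sub>R (e o\<^sub>L e)) x) x)"
      using accretive_correction_step[OF A jordan_algebra_add[OF A(1) a d] \<rho>(1) b \<rho>(2)] by blast
    have "norm (e o\<^sub>L e) \<le> 1" using norm_compose_le[OF e(2) e(2)] by simp
    then have "norm (\<rho> n *\<^sub>R (e o\<^sub>L e)) \<le> \<rho> n"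
      using \<rho>(1)[of n] mult_left_mono[of "norm (e o\<^sub>L e)" 1 "\<rho> n"] by simp
    then have "ok (Suc n) (d + \<rho> n *\<^sub>R (e o\<^sub>L e)) \<and> norm (d + \<rho> n *\<^sub>R (e o\<^sub>L e) - d) \<le> \<rho> n"
      using e d unfolding ok_def
      by (auto simp: add.assoc intro!: jordan_algebra_add[OF A(1)] jordan_algebra_scaleR[OF A(1)]
          jordan_algebra_square[OF A(1)])
    then show ?thesis by blast
  qed
  ultimately obtain D where D: "\<And>n. ok n (D n)" "\<And>n. norm (D (Suc n) - D n) \<le> \<rho> n"
    using dependent_nat_choice[of ok "\<lambda>n d d'. norm (d' - d) \<le> \<rho> n"] by blast
  have "(\<lambda>n. \<delta> * (1/2) ^ Suc n) sums (\<delta> * 1)"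
    using power_half_series by (rule sums_mult)
  then have "(\<lambda>n. \<rho> (Suc n)) sums \<delta>"
    by (simp add: \<rho>_def power_one_over divide_simps)
  then have \<rho>_sums: "\<rho> sums (\<delta> + r)"
    using sums_Suc[of \<rho> \<delta>] by (simp add: \<rho>_def[of 0])
  have norm_summable: "summable (\<lambda>n. norm (D (Suc n) - D n))"
    by (rule summable_comparison_test'[OF sums_summable[OF \<rho>_sums], of 0]) (simp add: D(2))
  define l where "l = (\<Sum>n. D (Suc n) - D n)"
  have "(\<lambda>n. D (Suc n) - D n) sums l"
    unfolding l_def by (rule summable_sums[OF summable_norm_cancel[OF norm_summable]])
  then have lim: "D \<longlonglongrightarrow> l"
    using D(1)[of 0] by (simp add: sums_def sum_lessThan_telescope ok_def)
  have "l \<in> A"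
    using closed_sequentially[OF jordan_algebra_closed[OF A(1)] _ lim] D(1) by (simp add: ok_def)
  moreover have "norm l \<le> r + \<delta>"
  proof -
    have "norm l \<le> (\<Sum>n. norm (D (Suc n) - D n))"
      unfolding l_def by (rule summable_norm[OF norm_summable])
    also have "\<dots> \<le> suminf \<rho>"
      by (intro suminf_le D(2) norm_summable sums_summable[OF \<rho>_sums])
    finally show ?thesis using sums_unique[OF \<rho>_sums] by simp
  qed
  moreover have "accretive (a + l)"
    unfolding accretive_def
  proof
    fix x
    have "(\<lambda>n. (a + D n) x) \<longlonglongrightarrow> (a + l) x"
      by (intro blinfun.tendsto tendsto_intros lim)
    then have "(\<lambda>n. Re (cinner ((a + D n) x) x)) \<longlonglongrightarrow> Re (cinner ((a + l) x) x)"
      by (rule bounded_linear.tendsto[rotated])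
        (rule bounded_linear_intro[of _ "norm x"],
         auto simp: cinner_add_left cinner_scaleR_left abs_Re_cinner_le)
    moreover have "(\<lambda>n. - \<rho> n * (norm x)\<^sup>2) \<longlonglongrightarrow> - 0 * (norm x)\<^sup>2"
      by (intro tendsto_intros summable_LIMSEQ_zero sums_summable[OF \<rho>_sums])
    ultimately have "- 0 * (norm x)\<^sup>2 \<le> Re (cinner ((a + l) x) x)"
      using D(1) by (intro LIMSEQ_le[of _ _ "\<lambda>n. Re (cinner ((a + D n) x) x)"]) (auto simp: ok_def)
    then show "0 \<le> Re (cinner ((a + l) x) x)" by simp
  qed
  ultimately show ?thesis using that by blast
qed

section \<open>The identity of a unital algebra\<close>

context
  fixes A :: "('h::complex_hilbert_space \<Rightarrow>\<^sub>L 'h) set" and p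
  assumes A: "jordan_operator_algebra A" and p: "is_identity A p"
begin

lemma identity_idempotent: "p o\<^sub>L p = p"
  using p jordan_prod_commuting[of p p] by (simp add: is_identity_def)

text \<open>A Jordan identity is an identity on both sides: multiplying \<open>p a + a p = 2 a\<close> by the idempotent \<open>p\<close>
  from either side shows that \<open>p a\<close> and \<open>a p\<close> both equal \<open>p a p\<close>.\<close>

lemma identity_compose:
  assumes "a \<in> A"
  shows "p o\<^sub>L a = a" "a o\<^sub>L p = a"
proof -
  have "(1/2) *\<^sub>R ((p o\<^sub>L a) + (a o\<^sub>L p)) = a"
    using p assms unfolding is_identity_def jordan_prod_def by blast
  from arg_cong[OF this, of "scaleR 2"] have sum: "(p o\<^sub>L a) + (a o\<^sub>L p) = 2 *\<^sub>R a"
    by simp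
  have "p o\<^sub>L (a o\<^sub>L p) = p o\<^sub>L a"
  proof -
    have "p o\<^sub>L ((p o\<^sub>L a) + (a o\<^sub>L p)) = (p o\<^sub>L a) + (p o\<^sub>L (a o\<^sub>L p))"
      by (simp add: compose_linear identity_idempotent flip: blinfun_compose_assoc)
    then show ?thesis unfolding sum by (simp add: compose_linear scaleR_2)
  qed
  moreover have "(p o\<^sub>L a) o\<^sub>L p = a o\<^sub>L p"
  proof -
    have "((p o\<^sub>L a) + (a o\<^sub>L p)) o\<^sub>L p = ((p o\<^sub>L a) o\<^sub>L p) + (a o\<^sub>L p)"
      by (simp add: compose_linear identity_idempotent blinfun_compose_assoc)
    then show ?thesis unfolding sum by (simp add: compose_linear scaleR_2)
  qed
  ultimately have "p o\<^sub>L a = a o\<^sub>L p" by (simp add: blinfun_compose_assoc)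
  with sum show "p o\<^sub>L a = a" "a o\<^sub>L p = a"
    by (simp_all flip: scaleR_2)
qed

lemma identity_apply: "a \<in> A \<Longrightarrow> p (a x) = a x" "a \<in> A \<Longrightarrow> a (p x) = blinfun_apply a x"
  using identity_compose by (metis blinfun_apply_blinfun_compose)+

lemma identity_in: "p \<in> A" and identity_norm: "norm p = 1"
  using p by (auto simp: is_identity_def)

lemma identity_norm_le: "norm (p x) \<le> norm x"
  by (simp add: norm_contraction identity_norm)

text \<open>Contractive idempotents are orthogonal projections: \<open>p\<close> fixes its range, hence so does its adjoint,
  and therefore \<open>p = p* p\<close>.\<close>

lemma identity_selfadjoint: "cinner (p x) y = cinner x (p y)"
proof -
  note adj = cinner_cadjoint[OF jordan_algebra_bounded[OF A identity_in]]
  have fix_adj: "cadjoint p (p x) = p x" for x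
    using contraction_fixes_adjoint_fixes[OF adj, of "p x" "norm (p x)" 0]
      norm_cadjoint_le[OF jordan_algebra_bounded[OF A identity_in]]
    by (simp add: identity_norm identity_apply identity_in)
  have "cinner (p x) y = cinner (cadjoint p (p x)) y" by (simp add: fix_adj)
  also have "\<dots> = cinner (p x) (p y)"
    by (rule cinner_cadjoint_left[OF jordan_algebra_bounded[OF A identity_in]])
  also have "\<dots> = cinner x (cadjoint p (p y))" by (rule adj)
  finally show ?thesis by (simp add: fix_adj)
qed

lemma identity_cinner: "cinner (p x) x = of_real ((norm (p x))\<^sup>2)"
  by (metis identity_selfadjoint identity_apply(1) identity_in norm_power2_eq_cinner)

lemma cinner_compress:
  assumes "a \<in> A"
  shows "cinner (blinfun_apply a x) x = cinner (a (p x)) (p x)"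
  using identity_selfadjoint[of "a x" x] assms by (simp add: identity_apply)

end

section \<open>Unital real positive maps are contractive\<close>

lemma root_of_unity_power_eq_1:
  assumes N: "N > 0" and \<omega>: "\<omega> = cis (2 * pi / real N)"
  shows "\<omega> ^ k = 1 \<longleftrightarrow> N dvd k"
proof -
  have "\<omega> ^ k = exp (2 * of_real pi * \<i> * of_nat k / of_nat N)"
    unfolding \<omega> Complex.DeMoivre unfolding cis_conv_exp
    by (intro arg_cong[where f = exp]) (simp add: mult_ac)
  then show ?thesis using complex_root_unity_eq_1[of N k] N by simp
qed

lemma sum_powers_of_roots_of_unity:
  assumes N: "N > 0" and \<omega>: "\<omega> = cis (2 * pi / real N)"
  shows "(\<Sum>m<N. (\<omega> ^ m) ^ k) = (if N dvd k then of_nat N else 0)"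
proof -
  note eq1 = root_of_unity_power_eq_1[OF N \<omega>]
  have swap: "(\<omega> ^ m) ^ k = (\<omega> ^ k) ^ m" for m
    by (simp add: mult.commute flip: power_mult)
  show ?thesis
  proof (cases "N dvd k")
    case True
    then have "\<omega> ^ k = 1" by (simp add: eq1)
    with True show ?thesis by (simp add: swap)
  next
    case False
    have "(\<omega> ^ k) ^ N = 1"
      using eq1[of "k * N"] by (simp add: power_mult)
    with False show ?thesis by (simp add: swap geometric_sum eq1)
  qed
qed

lemma complex_linear_map_sum:
  assumes A: "jordan_operator_algebra A" and S: "complex_linear_map A C S"
    and "finite I" "\<And>i. i \<in> I \<Longrightarrow> f i \<in> A"
  shows "S (\<Sum>i\<in>I. f i) = (\<Sum>i\<in>I. S (f i))"
  using assms(3,4)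
proof (induction I rule: finite_induct)
  case empty
  have "S (0 + 0) = S 0 + S 0"
    using S jordan_algebra_zero[OF A] unfolding complex_linear_map_def by blast
  then show ?case by simp
next
  case (insert i I)
  then have "S (f i + sum f I) = S (f i) + S (sum f I)"
    using S jordan_algebra_sum[OF A, of I f] unfolding complex_linear_map_def by blast
  with insert show ?case by simp
qed

text \<open>With \<open>w = v + Z v + \<dots> + Z\<^sup>M\<^sup>-\<^sup>1 v\<close> one has \<open>Z w = w - v + Z\<^sup>M v\<close>. Up to the last term, \<open>norm (Z w) \<le> norm w\<close> says
  \<open>0 \<le> Re \<langle>2 w - v, v\<rangle>\<close>, which is accretivity of the Cayley transform \<open>(1 + Z) (1 - Z)\<^sup>-\<^sup>1\<close> truncated at
  order \<open>M\<close>.\<close>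

lemma cayley_partial_sum_bound:
  fixes Z :: "'h::complex_hilbert_space \<Rightarrow> 'h"
  assumes lin: "linear Z" and Z: "\<And>v. norm (Z v) \<le> \<theta> * norm v" and \<theta>: "0 \<le> \<theta>" "\<theta> \<le> 1"
  shows "- (2 * real (Suc M) * \<theta> ^ M) * (norm v)\<^sup>2 \<le> Re (cinner (2 *\<^sub>R (\<Sum>n<M. (Z ^^ n) v) - v) v)"
proof -
  define w where "w = (\<Sum>n<M. (Z ^^ n) v)"
  have Zn: "norm ((Z ^^ n) v) \<le> \<theta> ^ n * norm v" for n
  proof (induction n)
    case (Suc n)
    then have "norm (Z ((Z ^^ n) v)) \<le> \<theta> * (\<theta> ^ n * norm v)"
      using Z[of "(Z ^^ n) v"] \<theta> by (meson mult_left_mono order_trans)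
    then show ?case by (simp add: mult.assoc)
  qed simp
  have "Z w = (\<Sum>n<M. Z ((Z ^^ n) v))"
    unfolding w_def using lin by (rule linear_sum)
  moreover have "(\<Sum>n<M. Z ((Z ^^ n) v)) + v = (\<Sum>n<M. (Z ^^ n) v) + (Z ^^ M) v"
    by (induction M) (simp_all add: algebra_simps)
  ultimately have Zw: "Z w = (w - v) + (Z ^^ M) v"
    by (simp add: w_def algebra_simps)
  have "norm (w - v) \<le> real (Suc M) * norm v"
  proof -
    have "norm w \<le> (\<Sum>n<M. norm v)"
      unfolding w_def
    proof (rule sum_norm_le)
      fix n
      show "norm ((Z ^^ n) v) \<le> norm v"
        using Zn[of n] mult_right_mono[OF power_le_one[OF \<theta>], of "norm v" n] by simp
    qed
    then show ?thesis using norm_triangle_ineq4[of w v] by (simp add: algebra_simps)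
  qed
  then have "norm (w - v) * norm ((Z ^^ M) v) \<le> (real (Suc M) * norm v) * (\<theta> ^ M * norm v)"
    using Zn by (intro mult_mono) auto
  then have cross: "\<bar>Re (cinner (w - v) ((Z ^^ M) v))\<bar> \<le> real (Suc M) * \<theta> ^ M * (norm v)\<^sup>2"
    using abs_Re_cinner_le[of "w - v" "(Z ^^ M) v"] by (simp add: power2_eq_square mult_ac)
  have "norm (Z w) \<le> norm w"
    using Z[of w] mult_right_mono[OF \<theta>(2), of "norm w"] by simp
  then have "(norm (Z w))\<^sup>2 \<le> (norm w)\<^sup>2"
    by (rule power_mono) simp
  then have "2 * Re (cinner (w - v) ((Z ^^ M) v)) \<le> 2 * Re (cinner w v) - (norm v)\<^sup>2"
    unfolding Zw norm_add_power2 norm_diff_power2[of w v]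
    using zero_le_power2[of "norm ((Z ^^ M) v)"] by linarith
  moreover have "Re (cinner (2 *\<^sub>R w - v) v) = 2 * Re (cinner w v) - (norm v)\<^sup>2"
    by (simp add: cinner_diff_left cinner_scaleR_left Re_cinner_self)
  ultimately have "- (2 * (real (Suc M) * \<theta> ^ M * (norm v)\<^sup>2)) \<le> Re (cinner (2 *\<^sub>R w - v) v)"
    using cross by linarith
  then show ?thesis unfolding w_def[symmetric] by (simp add: algebra_simps)
qed

text \<open>The polynomial \<open>Q z = (1 + \<epsilon>) p + 2 (z x + \<dots> + (z x)\<^sup>M\<^sup>-\<^sup>1)\<close> is accretive for \<open>\<bar>z\<bar> = 1\<close> by
  \<open>cayley_partial_sum_bound\<close>, hence so is \<open>S (Q z)\<close>. Test it on the vector \<open>u - z v\<close> and average over the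
  \<open>(M + 1)\<close>-st roots of unity \<open>z\<close>: the diagonal terms leave the constant coefficient \<open>(1 + \<epsilon>) q\<close>, one
  cross term leaves \<open>2 \<langle>S x u, v\<rangle>\<close>, and the other vanishes. What remains is
  \<open>2 Re \<langle>S x u, v\<rangle> \<le> (1 + \<epsilon>) ((norm u)\<^sup>2 + (norm v)\<^sup>2)\<close>, which bounds \<open>norm (S x)\<close> by \<open>1 + \<epsilon>\<close>.\<close>

lemma unital_real_positive_contractive_aux:
  fixes A :: "('h::complex_hilbert_space \<Rightarrow>\<^sub>L 'h) set"
    and C :: "('l::complex_hilbert_space \<Rightarrow>\<^sub>L 'l) set"
  assumes A: "jordan_operator_algebra A" and p: "is_identity A p"
    and C: "jordan_operator_algebra C" and q: "is_identity C q"
    and S: "complex_linear_map A C S" and Sp: "S p = q"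
    and pos: "\<And>a. a \<in> A \<Longrightarrow> accretive a \<Longrightarrow> accretive (S a)"
    and x: "x \<in> A" and x1: "norm x < 1" and M: "M \<ge> 2"
  shows "norm (S x) \<le> 1 + 2 * real (Suc M) * norm x ^ M"
proof -
  define \<epsilon> where "\<epsilon> = 2 * real (Suc M) * norm x ^ M"
  have \<epsilon>: "\<epsilon> \<ge> 0" by (simp add: \<epsilon>_def)
  define pw where "pw = rec_nat p (\<lambda>_ w. x \<circ>\<^sub>J w)"
  have pw0: "pw 0 = p" and pwS: "pw (Suc n) = x \<circ>\<^sub>J pw n" for n
    by (simp_all add: pw_def)
  have pwA: "pw n \<in> A" for n
    by (induction n) (simp_all add: pw0 pwS x identity_in[OF A p] jordan_algebra_jordan_prod[OF A])
  have pw_comm: "x o\<^sub>L pw n = pw n o\<^sub>L x" for n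
  proof (induction n)
    case 0
    then show ?case by (simp add: pw0 identity_compose[OF A p x])
  next
    case (Suc n)
    then show ?case
      unfolding pwS jordan_prod_commuting[OF Suc] by (simp only: blinfun_compose_assoc Suc[symmetric])
  qed
  have pw1: "pw 1 = x"
    using p x by (simp add: pw0 pwS jordan_prod_commute[of x] is_identity_def)
  have pw_apply: "blinfun_apply (pw n) u = ((blinfun_apply x) ^^ n) (p u)" for n u
    by (induction n) (simp_all add: pw0 pwS jordan_prod_commuting[OF pw_comm])
  define \<alpha> where "\<alpha> n = (if n = 0 then complex_of_real (1 + \<epsilon>) else 2)" for n :: nat
  define Q where "Q z = (\<Sum>n<M. scaleC_op (\<alpha> n * z ^ n) (pw n))" for z
  have QA: "Q z \<in> A" for z
    unfolding Q_def by (intro jordan_algebra_sum[OF A] jordan_algebra_scaleC[OF A] pwA)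
  have Q_acc: "accretive (Q z)" if z: "cmod z = 1" for z
    unfolding accretive_def
  proof
    fix u
    define v where "v = p u"
    define Z where "Z y = z *\<^sub>C blinfun_apply x y" for y
    have x_scaleC: "x (c *\<^sub>C y) = c *\<^sub>C x y" for c y
      using jordan_algebra_bounded[OF A x] by (simp add: bounded_operators_def)
    have Z_lin: "linear Z"
      by (rule linearI) (simp_all add: Z_def blinfun_linear scaleC_add_right scaleR_scaleC
          scaleC_scaleC mult.commute x_scaleC)
    have Zn: "(Z ^^ n) y = z ^ n *\<^sub>C ((blinfun_apply x) ^^ n) y" for n y
      by (induction n) (simp_all add: Z_def x_scaleC scaleC_scaleC)
    have Z_norm: "norm (Z y) \<le> norm x * norm y" for y
      by (simp add: Z_def norm_scaleC z norm_blinfun)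
    obtain K where K: "M = Suc K" using M by (cases M) auto
    have "Q z v = (\<Sum>n<M. \<alpha> n *\<^sub>C (Z ^^ n) v)"
      by (simp add: Q_def blinfun.sum_left pw_apply v_def identity_apply[OF A p] identity_in[OF A p]
          Zn scaleC_scaleC)
    moreover have "2 *\<^sub>C y = y + y" for y :: 'h
      using scaleC_add_left[of 1 1 y] by simp
    ultimately have "Q z v = \<epsilon> *\<^sub>R v + (2 *\<^sub>R (\<Sum>n<M. (Z ^^ n) v) - v)"
      unfolding K sum.lessThan_Suc_shift
      by (simp add: \<alpha>_def scaleR_scaleC scaleC_add_left scaleR_2 sum.distrib)
    note Qv = this
    have "Re (cinner (Q z u) u) = Re (cinner (Q z v) v)"
      unfolding v_def by (subst cinner_compress[OF A p QA]) (rule refl)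
    also have "\<dots> = \<epsilon> * (norm v)\<^sup>2 + Re (cinner (2 *\<^sub>R (\<Sum>n<M. (Z ^^ n) v) - v) v)"
      by (simp add: Qv cinner_add_left cinner_scaleR_left Re_cinner_self)
    finally show "0 \<le> Re (cinner (Q z u) u)"
      using cayley_partial_sum_bound[OF Z_lin Z_norm norm_ge_zero, of M v] x1
      by (simp add: \<epsilon>_def)
  qed
  define y where "y n = S (pw n)" for n
  have SQ: "S (Q z) = (\<Sum>n<M. scaleC_op (\<alpha> n * z ^ n) (y n))" for z
    unfolding Q_def y_def using S pwA jordan_algebra_scaleC[OF A]
    by (subst complex_linear_map_sum[OF A S]) (auto simp: complex_linear_map_def)
  define N where "N = Suc M"
  define \<omega> where "\<omega> = cis (2 * pi / real N)"
  have N: "N > 0" by (simp add: N_def)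
  note roots = sum_powers_of_roots_of_unity[OF N \<omega>_def]
  have c1: "cmod (\<omega> ^ m) = 1" for m by (simp add: \<omega>_def norm_power)
  \<comment> \<open>A root of unity of order \<open>M + 1\<close> turns conjugation into the power \<open>M\<close>, so that all averages below
    are averages of powers.\<close>
  have cN: "cnj (\<omega> ^ m) = (\<omega> ^ m) ^ M" for m
  proof -
    have "(\<omega> ^ m) ^ N = 1"
      using root_of_unity_power_eq_1[OF N \<omega>_def, of "m * N"] by (simp add: power_mult)
    then have "\<omega> ^ m * (\<omega> ^ m) ^ M = 1" by (simp add: N_def)
    moreover have "\<omega> ^ m * cnj (\<omega> ^ m) = 1"
      by (simp only: complex_norm_square[symmetric] c1) simp
    ultimately show ?thesis
      by (metis mult_cancel_left zero_neq_one mult_zero_left)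
  qed
  have avg: "(\<Sum>m<N. (\<omega> ^ m) ^ k * (\<Sum>n<M. h n * (\<omega> ^ m) ^ n))
      = (\<Sum>n<M. h n * (if N dvd k + n then of_nat N else 0))" for k and h :: "nat \<Rightarrow> complex"
  proof -
    have "(\<Sum>m<N. (\<omega> ^ m) ^ k * (\<Sum>n<M. h n * (\<omega> ^ m) ^ n))
        = (\<Sum>m<N. \<Sum>n<M. h n * (\<omega> ^ m) ^ (k + n))"
      by (simp add: sum_distrib_left power_add mult_ac)
    also have "\<dots> = (\<Sum>n<M. h n * (\<Sum>m<N. (\<omega> ^ m) ^ (k + n)))"
      by (subst sum.swap) (simp add: sum_distrib_left)
    finally show ?thesis by (simp only: roots)
  qed
  have key: "2 * Re (cinner (S x u) v) \<le> (1 + \<epsilon>) * ((norm u)\<^sup>2 + (norm v)\<^sup>2)" for u v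
  proof -
    define H where "H u v z = (\<Sum>n<M. (\<alpha> n * cinner (y n u) v) * z ^ n)" for u v z
    have H: "cinner (S (Q z) u) v = H u v z" for u v z
      by (simp add: SQ H_def blinfun.sum_left cinner_sum_left cinner_scaleC_left mult_ac)
    have y0: "y 0 = q" and y1: "y 1 = S x"
      by (simp_all add: y_def pw0 Sp) (use pw1 in simp)
    have dvd0: "N dvd n \<longleftrightarrow> n = 0" if "n < M" for n
      using that by (auto simp: N_def dest: dvd_imp_le)
    have dvdM: "N dvd M + n \<longleftrightarrow> n = 1" if "n < M" for n
    proof
      assume "N dvd M + n"
      then obtain k where k: "M + n = N * k" by (elim dvdE)
      have "N * k < N * 2" "N * k \<noteq> 0" using that M unfolding k[symmetric] by (auto simp: N_def)
      then have "k = 1" by (simp only: mult_less_cancel1) (cases k, auto)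
      with k show "n = 1" by (simp add: N_def)
    qed (simp add: N_def)
    have dvd1: "\<not> N dvd 1 + n" if "n < M" for n
      using that by (auto simp: N_def dest: dvd_imp_le)
    have sum0: "(\<Sum>m<N. H u u (\<omega> ^ m)) = of_nat N * (of_real (1 + \<epsilon>) * cinner (q u) u)" for u
    proof -
      have "(\<Sum>m<N. H u u (\<omega> ^ m)) = (\<Sum>n<M. (\<alpha> n * cinner (y n u) u) * (if n = 0 then of_nat N else 0))"
        using avg[of 0 "\<lambda>n. \<alpha> n * cinner (y n u) u"] by (simp add: H_def dvd0 cong: sum.cong_simp)
      also have "\<dots> = (\<Sum>n<M. if n = 0 then of_nat N * (of_real (1 + \<epsilon>) * cinner (q u) u) else 0)"
        by (intro sum.cong) (auto simp: \<alpha>_def y0)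
      finally show ?thesis using M by simp
    qed
    have sumM: "(\<Sum>m<N. cnj (\<omega> ^ m) * H u v (\<omega> ^ m)) = of_nat N * (2 * cinner (S x u) v)"
    proof -
      have "(\<Sum>m<N. cnj (\<omega> ^ m) * H u v (\<omega> ^ m))
          = (\<Sum>n<M. (\<alpha> n * cinner (y n u) v) * (if n = 1 then of_nat N else 0))"
        using avg[of M "\<lambda>n. \<alpha> n * cinner (y n u) v"] unfolding cN by (simp add: H_def dvdM cong: sum.cong_simp)
      also have "\<dots> = (\<Sum>n<M. if n = 1 then of_nat N * (2 * cinner (S x u) v) else 0)"
        by (intro sum.cong) (auto simp: \<alpha>_def y1[unfolded One_nat_def])
      finally show ?thesis using M by simp
    qed
    have sum1: "(\<Sum>m<N. \<omega> ^ m * H v u (\<omega> ^ m)) = 0"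
      using avg[of 1 "\<lambda>n. \<alpha> n * cinner (y n v) u"] by (simp add: H_def dvd1[simplified] cong: sum.cong_simp)
    have "0 \<le> Re (\<Sum>m<N. cinner (S (Q (\<omega> ^ m)) (u - \<omega> ^ m *\<^sub>C v)) (u - \<omega> ^ m *\<^sub>C v))"
      unfolding Re_sum using pos[OF QA Q_acc[OF c1]]
      by (intro sum_nonneg) (simp add: accretive_def)
    also have "(\<Sum>m<N. cinner (S (Q (\<omega> ^ m)) (u - \<omega> ^ m *\<^sub>C v)) (u - \<omega> ^ m *\<^sub>C v))
      = (\<Sum>m<N. H u u (\<omega> ^ m) + H v v (\<omega> ^ m) - cnj (\<omega> ^ m) * H u v (\<omega> ^ m) - \<omega> ^ m * H v u (\<omega> ^ m))"
    proof (rule sum.cong[OF refl])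
      fix m
      define c where "c = \<omega> ^ m"
      define f where "f = S (Q c)"
      have "f \<in> C" using S QA by (auto simp: f_def complex_linear_map_def)
      then have f: "f (c *\<^sub>C v) = c *\<^sub>C f v"
        using jordan_algebra_bounded[OF C] by (auto simp: bounded_operators_def)
      have cc: "c * cnj c = 1" by (simp only: c_def complex_norm_square[symmetric] c1) simp
      have "cinner (f (u - c *\<^sub>C v)) (u - c *\<^sub>C v)
          = cinner (f u) u + (c * cnj c) * cinner (f v) v - cnj c * cinner (f u) v - c * cinner (f v) u"
        by (simp add: blinfun_linear f cinner_diff_left cinner_diff_right cinner_scaleC_left
            cinner_scaleC_right algebra_simps)
      then show "cinner (S (Q (\<omega> ^ m)) (u - \<omega> ^ m *\<^sub>C v)) (u - \<omega> ^ m *\<^sub>C v)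
        = H u u (\<omega> ^ m) + H v v (\<omega> ^ m) - cnj (\<omega> ^ m) * H u v (\<omega> ^ m) - \<omega> ^ m * H v u (\<omega> ^ m)"
        unfolding cc by (simp add: f_def c_def H)
    qed
    also have "\<dots> = of_nat N * (of_real (1 + \<epsilon>) * (cinner (q u) u + cinner (q v) v) - 2 * cinner (S x u) v)"
      unfolding sum_subtractf sum.distrib sum0 sumM sum1 by (simp add: algebra_simps)
    also have "Re \<dots> = real N * ((1 + \<epsilon>) * ((norm (q u))\<^sup>2 + (norm (q v))\<^sup>2) - 2 * Re (cinner (S x u) v))"
      by (simp add: identity_cinner[OF C q])
    finally have "2 * Re (cinner (S x u) v) \<le> (1 + \<epsilon>) * ((norm (q u))\<^sup>2 + (norm (q v))\<^sup>2)"
      using N by (simp add: zero_le_mult_iff)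
    also have "\<dots> \<le> (1 + \<epsilon>) * ((norm u)\<^sup>2 + (norm v)\<^sup>2)"
      using \<epsilon> identity_norm_le[OF C q] by (intro mult_left_mono add_mono power_mono) auto
    finally show ?thesis .
  qed
  have "norm (S x) \<le> 1 + \<epsilon>"
  proof (rule norm_blinfun_bound)
    fix u
    define s where "s = norm (S x u)"
    show "norm (S x u) \<le> (1 + \<epsilon>) * norm u"
    proof (cases "u = 0 \<or> s = 0")
      case True
      then show ?thesis using \<epsilon> by (auto simp: s_def blinfun_linear)
    next
      case False
      then have pos: "norm u > 0" "s > 0" by (auto simp: s_def)
      \<comment> \<open>Scaling \<open>S x u\<close> to the length of \<open>u\<close> makes the two squares in \<open>key\<close> equal.\<close>
      define t where "t = norm u / s"
      have "t * s = norm u" using pos by (simp add: t_def)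
      have "2 * (t * s * s) \<le> (1 + \<epsilon>) * ((norm u)\<^sup>2 + (t * s)\<^sup>2)"
        using key[of u "t *\<^sub>R S x u"] pos
        by (simp add: cinner_scaleR_right Re_cinner_self s_def[symmetric] power_mult_distrib)
          (simp add: power2_eq_square mult_ac)
      then have "norm u * s \<le> norm u * ((1 + \<epsilon>) * norm u)"
        unfolding \<open>t * s = norm u\<close> by (simp add: power2_eq_square algebra_simps)
      then show ?thesis using pos by (simp add: s_def)
    qed
  qed (use \<epsilon> in simp)
  then show ?thesis by (simp add: \<epsilon>_def)
qed

text \<open>The error in \<open>unital_real_positive_contractive_aux\<close> vanishes for large \<open>M\<close> only if \<open>norm x < 1\<close>, so the
  open unit ball comes first and the general case follows by scaling.\<close>

lemma unital_real_positive_contractive: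
  fixes A :: "('h::complex_hilbert_space \<Rightarrow>\<^sub>L 'h) set"
    and C :: "('l::complex_hilbert_space \<Rightarrow>\<^sub>L 'l) set"
  assumes A: "jordan_operator_algebra A" and p: "is_identity A p"
    and C: "jordan_operator_algebra C" and q: "is_identity C q"
    and S: "complex_linear_map A C S" and Sp: "S p = q"
    and pos: "\<And>a. a \<in> A \<Longrightarrow> accretive a \<Longrightarrow> accretive (S a)"
    and x: "x \<in> A"
  shows "norm (S x) \<le> norm x"
proof (rule dense_ge)
  have ball: "norm (S y) \<le> 1" if y: "y \<in> A" "norm y < 1" for y
  proof -
    have "(\<lambda>M. 1 + 2 * (real M * norm y ^ M + norm y ^ M)) \<longlonglongrightarrow> 1 + 2 * (0 + 0)"
      using y by (intro tendsto_intros powser_times_n_limit_0 LIMSEQ_realpow_zero) auto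
    moreover have "\<forall>M\<ge>2. norm (S y) \<le> 1 + 2 * (real M * norm y ^ M + norm y ^ M)"
      using unital_real_positive_contractive_aux[OF A p C q S Sp pos y] by (auto simp: algebra_simps)
    ultimately have "norm (S y) \<le> 1 + 2 * (0 + 0)"
      by (intro LIMSEQ_le_const) auto
    then show ?thesis by simp
  qed
  fix t assume t: "norm x < t"
  then have t0: "t > 0" using norm_ge_zero[of x] by linarith
  have "S ((1/t) *\<^sub>R x) = (1/t) *\<^sub>R S x"
    using S x unfolding complex_linear_map_def scaleC_op_of_real[symmetric] by blast
  moreover have "norm ((1/t) *\<^sub>R x) < 1" using t t0 by simp
  ultimately have "norm ((1/t) *\<^sub>R S x) \<le> 1"
    using ball[OF jordan_algebra_scaleR[OF A x]] by metis
  then show "norm (S x) \<le> t" using t0 by (simp add: divide_simps)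
qed

section \<open>Unitizations\<close>

lemma jordan_prod_diff:
  "(a - b) \<circ>\<^sub>J c = a \<circ>\<^sub>J c - b \<circ>\<^sub>J c" "c \<circ>\<^sub>J (a - b) = c \<circ>\<^sub>J a - c \<circ>\<^sub>J b"
  by (simp_all add: jordan_prod_def compose_linear scaleR_diff_right scaleR_add_right)

lemma norm_jordan_prod_le:
  assumes "norm a \<le> c" "norm b \<le> d"
  shows "norm (a \<circ>\<^sub>J b) \<le> c * d"
proof -
  have "norm (a \<circ>\<^sub>J b) \<le> (norm (a o\<^sub>L b) + norm (b o\<^sub>L a)) / 2"
    using norm_triangle_ineq[of "a o\<^sub>L b" "b o\<^sub>L a"] by (simp add: jordan_prod_def)
  also have "\<dots> \<le> c * d"
    using norm_compose_le[OF assms] norm_compose_le[OF assms(2,1)] by (simp add: mult.commute)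
  finally show ?thesis .
qed

lemma embedding_image_approximately_unital:
  assumes A: "jordan_operator_algebra A" "approximately_unital A"
    and j: "isometric_jordan_embedding A B j"
  shows "approximately_unital (j ` A)"
proof -
  obtain F where F: "F \<noteq> bot" "\<forall>\<^sub>F e in F. e \<in> A \<and> norm e \<le> 1"
      "\<And>a. a \<in> A \<Longrightarrow> ((\<lambda>e. e \<circ>\<^sub>J a) \<longlongrightarrow> a) F"
    using A(2) by (auto simp: approximately_unital_def)
  have "((\<lambda>e. e \<circ>\<^sub>J j a) \<longlongrightarrow> j a) (filtermap j F)" if a: "a \<in> A" for a
    unfolding filterlim_filtermap
  proof (rule tendstoI)
    fix \<epsilon> :: real assume "\<epsilon> > 0"
    from tendstoD[OF F(3)[OF a] this] F(2) show "\<forall>\<^sub>F e in F. dist (j e \<circ>\<^sub>J j a) (j a) < \<epsilon>"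
    proof eventually_elim
      case (elim e)
      then have e: "e \<circ>\<^sub>J a \<in> A" using a by (simp add: jordan_algebra_jordan_prod[OF A(1)])
      have "j e \<circ>\<^sub>J j a - j a = j (e \<circ>\<^sub>J a - a)"
        using elim a e by (simp add: embedding_diff[OF A(1) j] embedding_jordan_prod[OF A(1) j])
      then show ?case
        using elim a e by (simp add: dist_norm embedding_norm[OF A(1) j] jordan_algebra_diff[OF A(1)])
    qed
  qed
  moreover have "\<forall>\<^sub>F e in filtermap j F. e \<in> j ` A \<and> norm e \<le> 1"
    using F(2) unfolding eventually_filtermap
    by eventually_elim (auto simp: embedding_norm[OF A(1) j])
  moreover have "filtermap j F \<noteq> bot" using F(1) by (simp add: filtermap_bot_iff)
  ultimately show ?thesis unfolding approximately_unital_def by blast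
qed

text \<open>For large \<open>R\<close> the element \<open>p - b / R\<close> has norm below \<open>1\<close>, so its powers tend to \<open>0\<close>, while all of them
  differ from \<open>p\<close> by an element of \<open>B\<close>. Since \<open>B\<close> is closed, it contains \<open>p\<close>.\<close>

lemma strictly_accretive_subspace_contains_identity:
  fixes A :: "('h::complex_hilbert_space \<Rightarrow>\<^sub>L 'h) set"
  assumes A: "jordan_operator_algebra A" and p: "is_identity A p"
    and B: "jordan_operator_algebra B" "B \<subseteq> A" and b: "b \<in> B"
    and s: "s > 0" and low: "\<And>u. s * (norm (p u))\<^sup>2 \<le> Re (cinner (blinfun_apply b u) u)"
  shows "p \<in> B"
proof -
  have bA: "b \<in> A" using b B(2) by blast
  \<comment> \<open>The fraction yields \<open>2 R s \<ge> (norm b)\<^sup>2 + 1\<close>; the summand \<open>1\<close> keeps \<open>R\<^sup>2 - 1\<close> nonnegative.\<close>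
  define R where "R = 1 + ((norm b)\<^sup>2 + 1) / (2 * s)"
  have R1: "R \<ge> 1" using s by (simp add: R_def)
  have Rs: "2 * R * s \<ge> (norm b)\<^sup>2 + 1"
    using s by (simp add: R_def field_simps)
  define \<theta> where "\<theta> = sqrt (R\<^sup>2 - 1) / R"
  have "sqrt (R\<^sup>2 - 1) < R" using R1 by (intro real_less_lsqrt) auto
  then have \<theta>: "0 \<le> \<theta>" "\<theta> < 1" using R1 by (simp_all add: \<theta>_def)
  define c where "c = (1/R) *\<^sub>R b"
  have c: "c \<in> B" by (simp add: c_def jordan_algebra_scaleR[OF B(1)] b)
  \<comment> \<open>This is the estimate \<open>(norm (R v - b v))\<^sup>2 \<le> (R\<^sup>2 - 2 R s + (norm b)\<^sup>2) (norm v)\<^sup>2\<close> on the range of \<open>p\<close>;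
    \<open>R\<close> makes the factor at most \<open>R\<^sup>2 - 1\<close>.\<close>
  have norm_z: "norm (p - c) \<le> \<theta>"
  proof (rule norm_blinfun_bound[OF \<theta>(1)])
    fix u
    define v where "v = p u"
    have pv: "p v = v" by (simp add: v_def identity_apply[OF A p] identity_in[OF A p])
    have "(norm (R *\<^sub>R v - b v))\<^sup>2 = R\<^sup>2 * (norm v)\<^sup>2 - 2 * R * Re (cinner (b v) v) + (norm (b v))\<^sup>2"
      by (rule norm_power2_scaled_diff)
    also have "\<dots> \<le> R\<^sup>2 * (norm v)\<^sup>2 - 2 * R * (s * (norm v)\<^sup>2) + (norm b * norm v)\<^sup>2"
      using low[of v] R1 power_mono[OF norm_blinfun[of b v], of 2]
      by (intro add_mono diff_mono mult_left_mono) (auto simp: pv)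
    also have "\<dots> = (R\<^sup>2 - 2 * R * s + (norm b)\<^sup>2) * (norm v)\<^sup>2"
      by (simp add: power_mult_distrib algebra_simps)
    also have "\<dots> \<le> (R\<^sup>2 - 1) * (norm v)\<^sup>2"
      using Rs by (intro mult_right_mono) auto
    also have "\<dots> = (sqrt (R\<^sup>2 - 1) * norm v)\<^sup>2"
      using R1 by (simp add: power_mult_distrib)
    finally have "norm (R *\<^sub>R v - b v) \<le> sqrt (R\<^sup>2 - 1) * norm v"
      by (rule power2_le_imp_le) (use R1 in simp)
    moreover have "(p - c) u = (1/R) *\<^sub>R (R *\<^sub>R v - b v)"
      using R1 by (simp add: v_def c_def blinfun_linear scaleR_diff_right identity_apply[OF A p] bA)
    ultimately have "norm ((p - c) u) \<le> \<theta> * norm v"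
      using R1 by (simp add: \<theta>_def divide_right_mono)
    also have "\<dots> \<le> \<theta> * norm u"
      unfolding v_def by (intro mult_left_mono identity_norm_le[OF A p] \<theta>)
    finally show "norm ((p - c) u) \<le> \<theta> * norm u" .
  qed
  define zn where "zn = rec_nat p (\<lambda>_ w. (p - c) \<circ>\<^sub>J w)"
  have zn0: "zn 0 = p" and znS: "zn (Suc n) = (p - c) \<circ>\<^sub>J zn n" for n
    by (simp_all add: zn_def)
  have "norm (zn n) \<le> \<theta> ^ n" for n
    by (induction n) (simp_all add: zn0 znS identity_norm[OF A p] norm_jordan_prod_le norm_z)
  moreover have "(\<lambda>n. \<theta> ^ n) \<longlonglongrightarrow> 0" using \<theta> by (intro LIMSEQ_realpow_zero)
  ultimately have "zn \<longlonglongrightarrow> 0"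
    by (intro Lim_null_comparison[of zn "\<lambda>n. \<theta> ^ n"]) auto
  then have lim: "(\<lambda>n. p - zn n) \<longlonglongrightarrow> p - 0"
    by (intro tendsto_intros)
  have unit: "p \<circ>\<^sub>J a = a" "a \<circ>\<^sub>J p = a" if "a \<in> A" for a
    using p that by (simp_all add: is_identity_def jordan_prod_commute[of a])
  have "p - zn n \<in> B" for n
  proof (induction n)
    case 0
    then show ?case by (simp add: zn0 jordan_algebra_zero[OF B(1)])
  next
    case (Suc n)
    define d where "d = p - zn n"
    have d: "d \<in> B" using Suc by (simp add: d_def)
    have "zn n = p - d" by (simp add: d_def)
    then have "p - zn (Suc n) = d + (c - c \<circ>\<^sub>J d)"
      using c d B(2) by (simp add: znS jordan_prod_diff unit identity_in[OF A p] subset_iff)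
    then show ?case
      using c d by (simp add: jordan_algebra_add[OF B(1)] jordan_algebra_diff[OF B(1)]
          jordan_algebra_jordan_prod[OF B(1)])
  qed
  then show ?thesis
    using closed_sequentially[OF jordan_algebra_closed[OF B(1)] _ lim] by simp
qed

lemma scaleC_op_simps [simp]:
  "scaleC_op c (scaleC_op d a) = scaleC_op (c * d) a"
  "scaleC_op 1 a = a" "scaleC_op 0 a = 0"
proof -
  have "0 *\<^sub>C x = 0" for x :: 'b
    using scaleC_add_left[of 0 0 x] by simp
  then show "scaleC_op c (scaleC_op d a) = scaleC_op (c * d) a" "scaleC_op 1 a = a" "scaleC_op 0 a = 0"
    by (auto intro!: blinfun_eqI simp: scaleC_scaleC)
qed

lemma scaleC_op_add:
  "scaleC_op (c + d) a = scaleC_op c a + scaleC_op d a"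
  "scaleC_op c (a + b) = scaleC_op c a + scaleC_op c b"
  by (auto intro!: blinfun_eqI simp: scaleC_add_left scaleC_add_right blinfun_linear)

lemma scaleC_op_diff: "scaleC_op (c - d) a = scaleC_op c a - scaleC_op d a"
  using scaleC_op_add(1)[of "c - d" d a] by (simp add: algebra_simps)

context
  fixes A :: "('h::complex_hilbert_space \<Rightarrow>\<^sub>L 'h) set"
    and A1 :: "('h1::complex_hilbert_space \<Rightarrow>\<^sub>L 'h1) set" and j p
  assumes A: "jordan_operator_algebra A" and unitization: "unitization A A1 j"
  defines "p \<equiv> identity_of A1"
begin

lemma unitization_algebra: "jordan_operator_algebra A1"
  using unitization by (simp add: unitization_def unital_jordan_operator_algebra_def)

lemma unitization_identity: "is_identity A1 p"
  using unitization identity_of_eq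
  by (auto simp: p_def unitization_def unital_jordan_operator_algebra_def)

lemma unitization_embedding: "isometric_jordan_embedding A A1 j"
  using unitization by (simp add: unitization_def)

lemma unitization_elements: "x \<in> A1 \<longleftrightarrow> (\<exists>a c. a \<in> A \<and> x = j a + scaleC_op c p)"
  using unitization unfolding unitization_def p_def by blast

lemma unitization_image_algebra: "jordan_operator_algebra (j ` A)"
  by (rule embedding_image_jordan_algebra[OF A unitization_embedding unitization_algebra])

lemma unitization_image_subset: "j ` A \<subseteq> A1"
  using embedding_in[OF A unitization_embedding] by blast

lemma identity_not_in_image: "p \<notin> j ` A"
proof
  assume "p \<in> j ` A"
  then have "A1 \<subseteq> j ` A"
    using jordan_algebra_add[OF unitization_image_algebra]
      jordan_algebra_scaleC[OF unitization_image_algebra] by (auto simp: unitization_elements)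
  with unitization_image_subset unitization show False
    by (auto simp: unitization_def)
qed

lemma unitization_decomposition_unique:
  assumes ab: "a \<in> A" "b \<in> A" and eq: "j a + scaleC_op c p = j b + scaleC_op d p"
  shows "a = b \<and> c = d"
proof -
  have "c = d"
  proof (rule ccontr)
    assume "c \<noteq> d"
    have "scaleC_op (c - d) p = j (b - a)"
      using eq ab by (simp add: scaleC_op_diff embedding_diff[OF A unitization_embedding] algebra_simps)
    then have "scaleC_op (1 / (c - d)) (scaleC_op (c - d) p) = scaleC_op (1 / (c - d)) (j (b - a))"
      by simp
    then have "p = scaleC_op (1 / (c - d)) (j (b - a))"
      using \<open>c \<noteq> d\<close> by simp
    moreover have "\<dots> \<in> j ` A"
      using ab by (intro jordan_algebra_scaleC[OF unitization_image_algebra] imageI jordan_algebra_diff[OF A])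
    ultimately show False using identity_not_in_image by simp
  qed
  moreover from this eq have "j a = j b" by simp
  then have "a = b" using embedding_inj[OF A unitization_embedding] ab by (simp add: inj_on_def)
  ultimately show ?thesis by simp
qed

lemma unitization_accretive_scalar_part:
  assumes a: "a \<in> A" and acc: "accretive (j a + scaleC_op c p)"
  shows "0 \<le> Re c"
proof (rule ccontr)
  assume neg: "\<not> 0 \<le> Re c"
  have "- Re c * (norm (p u))\<^sup>2 \<le> Re (cinner (j a u) u)" for u
  proof -
    have "0 \<le> Re (cinner (j a u) u) + Re (c * cinner (p u) u)"
      using acc by (auto simp: accretive_def blinfun_linear cinner_add_left cinner_scaleC_left)
    then show ?thesis
      by (simp add: identity_cinner[OF unitization_algebra unitization_identity])
  qed
  then have "p \<in> j ` A"
    using neg a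
    by (intro strictly_accretive_subspace_contains_identity[OF unitization_algebra
          unitization_identity unitization_image_algebra unitization_image_subset, of "j a" "- Re c"]) auto
  with identity_not_in_image show False by contradiction
qed

end

section \<open>Extension to the unitization\<close>

text \<open>The bound \<open>Re (k (T a)) \<ge> - Re c\<close> comes from applying \<open>T\<close> to the real positive elements \<open>a + d\<close> of
  \<open>accretive_dominating_element\<close> and letting \<open>\<delta>\<close> tend to \<open>0\<close>. The dominating element is found in the
  image of \<open>A\<close> inside \<open>A1\<close>, where the hypothesis lives, so real positivity travels from there back to
  \<open>A\<close>, through \<open>T\<close> to \<open>B\<close>, and on to \<open>C\<close>. Compressing by \<open>q\<close> at the end turns the lower bound \<open>- Re c\<close> times
  the identity operator into \<open>- Re c\<close> times \<open>q\<close>.\<close>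

lemma unital_extension_accretive:
  fixes A :: "('h::complex_hilbert_space \<Rightarrow>\<^sub>L 'h) set"
    and A1 :: "('h1::complex_hilbert_space \<Rightarrow>\<^sub>L 'h1) set"
    and B :: "('k::complex_hilbert_space \<Rightarrow>\<^sub>L 'k) set"
    and C :: "('l::complex_hilbert_space \<Rightarrow>\<^sub>L 'l) set"
  assumes A: "jordan_operator_algebra A" "approximately_unital A" and A1: "unitization A A1 j"
    and B: "jordan_operator_algebra B" and C: "jordan_operator_algebra C" and q: "is_identity C q"
    and k: "isometric_jordan_embedding B C k" and T: "real_positive_contraction A B T"
    and a: "a \<in> A" and acc: "accretive (j a + scaleC_op c (identity_of A1))"
  shows "accretive (k (T a) + scaleC_op c q)"
proof -
  define p where "p = identity_of A1"
  note j = unitization_embedding[OF A(1) A1]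
  note idA1 = unitization_algebra[OF A(1) A1] unitization_identity[OF A(1) A1, folded p_def]
  have r: "0 \<le> Re c"
    using unitization_accretive_scalar_part[OF A(1) A1 a acc] .
  have TA: "T b \<in> B" "norm (T b) \<le> norm b" "real_positive b \<Longrightarrow> real_positive (T b)" if "b \<in> A" for b
    using T that by (auto simp: real_positive_contraction_def complex_linear_map_def)
  have low: "- Re c * (norm x)\<^sup>2 \<le> Re (cinner (j a x) x)" for x
  proof -
    have "0 \<le> Re (cinner (j a x) x) + Re (c * cinner (p x) x)"
      using acc by (auto simp: accretive_def blinfun_linear cinner_add_left cinner_scaleC_left p_def)
    also have "Re (c * cinner (p x) x) = Re c * (norm (p x))\<^sup>2"
      by (simp add: identity_cinner[OF idA1])
    also have "\<dots> \<le> Re c * (norm x)\<^sup>2"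
      using r identity_norm_le[OF idA1] by (intro mult_left_mono power_mono) auto
    finally show ?thesis by simp
  qed
  have kT_low: "- Re c * (norm v)\<^sup>2 \<le> Re (cinner (k (T a) v) v)" for v
  proof -
    have "- (Re c + \<delta>) * (norm v)\<^sup>2 \<le> Re (cinner (k (T a) v) v)" if \<delta>: "\<delta> > 0" for \<delta>
    proof -
      obtain d' where d': "d' \<in> j ` A" "norm d' \<le> Re c + \<delta>" "accretive (j a + d')"
        using accretive_dominating_element[OF unitization_image_algebra[OF A(1) A1]
            embedding_image_approximately_unital[OF A j] imageI[OF a] r low \<delta>] by blast
      then obtain d where d: "d \<in> A" "d' = j d" by blast
      have ad: "a + d \<in> A" by (rule jordan_algebra_add[OF A(1) a d(1)])
      have jad: "j (a + d) \<in> j ` A" "accretive (j (a + d))"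
        using ad d'(3) by (simp, simp add: d(2) embedding_add[OF A(1) j a d(1)])
      have "accretive (inv_into A j (j (a + d)))"
        by (rule embedding_accretive[OF unitization_image_algebra[OF A(1) A1]
              embedding_inverse[OF A(1) j] jad])
      then have "accretive (a + d)"
        using embedding_inj[OF A(1) j] ad by simp
      then have "accretive (T (a + d))"
        using ad TA by (simp add: jordan_algebra_real_positive[OF A(1)] jordan_algebra_real_positive[OF B])
      then have "accretive (k (T (a + d)))"
        using TA(1)[OF ad] by (intro embedding_accretive[OF B k])
      moreover have "k (T (a + d)) = k (T a) + k (T d)"
        using T a d(1) TA(1) by (simp add: real_positive_contraction_def complex_linear_map_def
            embedding_add[OF B k])
      ultimately have "0 \<le> Re (cinner (k (T a) v) v) + Re (cinner (k (T d) v) v)"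
        by (auto simp: accretive_def blinfun_linear cinner_add_left)
      moreover have "Re (cinner (k (T d) v) v) \<le> (Re c + \<delta>) * (norm v)\<^sup>2"
      proof -
        have "norm (k (T d)) \<le> Re c + \<delta>"
          using d d'(2) TA(1,2)[OF d(1)]
          by (simp add: embedding_norm[OF B k] embedding_norm[OF A(1) j])
        then have "norm (k (T d) v) * norm v \<le> ((Re c + \<delta>) * norm v) * norm v"
          by (intro mult_right_mono norm_blinfun_le) auto
        then show ?thesis
          using Re_cinner_le[of "k (T d) v" v] by (simp add: power2_eq_square)
      qed
      ultimately show ?thesis unfolding mult_minus_left by linarith
    qed
    then have "\<forall>\<^sub>F \<delta> in at_right 0. - (Re c + \<delta>) * (norm v)\<^sup>2 \<le> Re (cinner (k (T a) v) v)"
      by (simp add: eventually_at_filter)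
    moreover have "((\<lambda>\<delta>. - (Re c + \<delta>) * (norm v)\<^sup>2) \<longlongrightarrow> - (Re c + 0) * (norm v)\<^sup>2) (at_right 0)"
      by (intro tendsto_intros)
    ultimately have "- (Re c + 0) * (norm v)\<^sup>2 \<le> Re (cinner (k (T a) v) v)"
      by (intro tendsto_upperbound[of _ _ "at_right 0"]) auto
    then show ?thesis by simp
  qed
  show ?thesis
    unfolding accretive_def
  proof
    fix v
    have kT: "k (T a) \<in> C" using embedding_in[OF B k] TA(1)[OF a] .
    have "Re (cinner ((k (T a) + scaleC_op c q) v) v)
        = Re (cinner (k (T a) (q v)) (q v)) + Re c * (norm (q v))\<^sup>2"
      using cinner_compress[OF C q kT, of v]
      by (simp add: blinfun_linear cinner_add_left cinner_scaleC_left identity_cinner[OF C q])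
    then show "0 \<le> Re (cinner ((k (T a) + scaleC_op c q) v) v)"
      using kT_low[of "q v"] by simp
  qed
qed

text \<open>The values of \<open>S\<close> on all of \<open>A1\<close> are part of the statement because idempotence of the extension of a
  projection is read off from them.\<close>

lemma unital_extension_exists:
  fixes A :: "('h::complex_hilbert_space \<Rightarrow>\<^sub>L 'h) set"
    and A1 :: "('h1::complex_hilbert_space \<Rightarrow>\<^sub>L 'h1) set"
    and B :: "('k::complex_hilbert_space \<Rightarrow>\<^sub>L 'k) set"
    and C :: "('l::complex_hilbert_space \<Rightarrow>\<^sub>L 'l) set"
  assumes A: "jordan_operator_algebra A" "approximately_unital A" and A1: "unitization A A1 j"
    and B: "jordan_operator_algebra B" and C: "unital_jordan_operator_algebra C"
    and k: "isometric_jordan_embedding B C k" and T: "real_positive_contraction A B T"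
  obtains S where "real_positive_contraction A1 C S" "unital_map A1 C S"
    "\<And>a c. a \<in> A \<Longrightarrow> S (j a + scaleC_op c (identity_of A1)) = k (T a) + scaleC_op c (identity_of C)"
proof -
  define p where "p = identity_of A1"
  define q where "q = identity_of C"
  note j = unitization_embedding[OF A(1) A1]
  note idA1 = unitization_algebra[OF A(1) A1] unitization_identity[OF A(1) A1, folded p_def]
  note unique = unitization_decomposition_unique[OF A(1) A1, folded p_def]
  note elements = unitization_elements[OF A(1) A1, folded p_def]
  have C': "jordan_operator_algebra C" and q: "is_identity C q"
    using C identity_of_eq by (auto simp: unital_jordan_operator_algebra_def q_def)
  have T_lin: "complex_linear_map A B T"
    using T by (simp add: real_positive_contraction_def)
  have TA: "T a \<in> B" if "a \<in> A" for a
    using T_lin that by (auto simp: complex_linear_map_def)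
  have T_add: "T (a + b) = T a + T b" if "a \<in> A" "b \<in> A" for a b
    using T_lin that by (simp add: complex_linear_map_def)
  have T_scaleC: "T (scaleC_op c a) = scaleC_op c (T a)" if "a \<in> A" for a c
    using T_lin that by (simp add: complex_linear_map_def)
  define S where "S x = (THE y. \<exists>a c. a \<in> A \<and> x = j a + scaleC_op c p \<and> y = k (T a) + scaleC_op c q)" for x
  have S: "S (j a + scaleC_op c p) = k (T a) + scaleC_op c q" if "a \<in> A" for a c
    unfolding S_def using that unique by (intro the_equality) blast+
  have kT: "k (T a) + scaleC_op c q \<in> C" if "a \<in> A" for a c
    using that TA by (intro jordan_algebra_add[OF C'] jordan_algebra_scaleC[OF C'] embedding_in[OF B k]
        identity_in[OF C' q])
  have S_lin: "complex_linear_map A1 C S"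
    unfolding complex_linear_map_def
  proof (intro conjI ballI allI)
    show "S \<in> A1 \<rightarrow> C"
      using S kT by (auto simp: elements)
  next
    fix x y assume "x \<in> A1" "y \<in> A1"
    then obtain a c b d where x: "a \<in> A" "x = j a + scaleC_op c p" and y: "b \<in> A" "y = j b + scaleC_op d p"
      unfolding elements by blast
    have "x + y = j (a + b) + scaleC_op (c + d) p"
      using x y by (simp add: embedding_add[OF A(1) j] scaleC_op_add algebra_simps)
    then have "S (x + y) = k (T (a + b)) + scaleC_op (c + d) q"
      using x y by (simp add: S jordan_algebra_add[OF A(1)])
    then show "S (x + y) = S x + S y"
      using x y by (simp add: S T_add TA embedding_add[OF B k] scaleC_op_add algebra_simps)
  next
    fix d x assume "x \<in> A1"
    then obtain a c where x: "a \<in> A" "x = j a + scaleC_op c p"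
      unfolding elements by blast
    have "scaleC_op d x = j (scaleC_op d a) + scaleC_op (d * c) p"
      using x by (simp add: embedding_scaleC[OF A(1) j] scaleC_op_add)
    then have "S (scaleC_op d x) = k (T (scaleC_op d a)) + scaleC_op (d * c) q"
      using x by (simp add: S jordan_algebra_scaleC[OF A(1)])
    then show "S (scaleC_op d x) = scaleC_op d (S x)"
      using x by (simp add: S T_scaleC TA embedding_scaleC[OF B k] scaleC_op_add)
  qed
  have S_acc: "accretive (S x)" if "x \<in> A1" "accretive x" for x
  proof -
    obtain a c where x: "a \<in> A" "x = j a + scaleC_op c p"
      using \<open>x \<in> A1\<close> unfolding elements by blast
    show ?thesis
      using unital_extension_accretive[OF A A1 B C' q k T x(1), of c, folded p_def] \<open>accretive x\<close>
      by (simp add: x S)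
  qed
  have Sp: "S p = q"
  proof -
    have zero: "0 \<in> A" by (rule jordan_algebra_zero[OF A(1)])
    have "j 0 = 0" using embedding_diff[OF A(1) j zero zero] by simp
    moreover have "k (T 0) = 0"
      using embedding_diff[OF B k TA[OF zero] TA[OF zero]] T_scaleC[OF zero, of 0]
        embedding_scaleC[OF B k TA[OF zero], of 0] by simp
    ultimately show ?thesis using S[OF zero, of 1] by simp
  qed
  show ?thesis
  proof (rule that)
    show "real_positive_contraction A1 C S"
      unfolding real_positive_contraction_def
    proof (intro conjI ballI impI)
      fix x assume x: "x \<in> A1"
      show "norm (S x) \<le> norm x"
        by (rule unital_real_positive_contractive[OF idA1 C' q S_lin Sp S_acc x])
      assume "real_positive x"
      moreover have "S x \<in> C" using S_lin x by (auto simp: complex_linear_map_def)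
      ultimately show "real_positive (S x)"
        using x S_acc by (simp add: jordan_algebra_real_positive[OF idA1(1)] jordan_algebra_real_positive[OF C'])
    qed (rule S_lin)
    show "unital_map A1 C S"
      using Sp by (simp add: unital_map_def p_def q_def)
  qed (use S in \<open>simp add: p_def q_def\<close>)
qed

theorem theorem2p3:
  fixes A :: "('h::complex_hilbert_space \<Rightarrow>\<^sub>L 'h) set"
    and A1 :: "('h1::complex_hilbert_space \<Rightarrow>\<^sub>L 'h1) set"
    and B :: "('k::complex_hilbert_space \<Rightarrow>\<^sub>L 'k) set"
    and C :: "('l::complex_hilbert_space \<Rightarrow>\<^sub>L 'l) set"
    and j :: "('h \<Rightarrow>\<^sub>L 'h) \<Rightarrow> ('h1 \<Rightarrow>\<^sub>L 'h1)"
    and k :: "('k \<Rightarrow>\<^sub>L 'k) \<Rightarrow> ('l \<Rightarrow>\<^sub>L 'l)"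
  assumes "jordan_operator_algebra A" and "approximately_unital A"
    and "jordan_operator_algebra B" and "approximately_unital B"
    and "unitization A A1 j"
    and "unital_jordan_operator_algebra C" and "isometric_jordan_embedding B C k"
  shows "(\<forall>T. real_positive_contraction A B T \<longrightarrow>
            (\<exists>S. real_positive_contraction A1 C S \<and> unital_map A1 C S \<and>
                 (\<forall>a\<in>A. S (j a) = k (T a)))) \<and>
         (\<forall>P. real_positive_contractive_projection A P \<longrightarrow>
            (\<exists>Q. real_positive_contractive_projection A1 Q \<and> unital_map A1 A1 Q \<and>
                 (\<forall>a\<in>A. Q (j a) = j (P a))))"
proof (intro conjI allI impI)
  note A = assms(1,2) and A1 = assms(5)
  fix T assume "real_positive_contraction A B T"
  then obtain S where S: "real_positive_contraction A1 C S" "unital_map A1 C S"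
    "\<And>a c. a \<in> A \<Longrightarrow> S (j a + scaleC_op c (identity_of A1)) = k (T a) + scaleC_op c (identity_of C)"
    using unital_extension_exists[OF A A1 assms(3,6,7)] by blast
  have "S (j a) = k (T a)" if "a \<in> A" for a
    using S(3)[OF that, of 0] by simp
  with S show "\<exists>S. real_positive_contraction A1 C S \<and> unital_map A1 C S \<and> (\<forall>a\<in>A. S (j a) = k (T a))"
    by blast
next
  note A = assms(1,2) and A1 = assms(5)
  fix P assume P: "real_positive_contractive_projection A P"
  have unital: "unital_jordan_operator_algebra A1" using A1 by (simp add: unitization_def)
  have "real_positive_contraction A A P"
    using P by (simp add: real_positive_contractive_projection_def)
  then obtain Q where Q: "real_positive_contraction A1 A1 Q" "unital_map A1 A1 Q"
    "\<And>a c. a \<in> A \<Longrightarrow> Q (j a + scaleC_op c (identity_of A1)) = j (P a) + scaleC_op c (identity_of A1)"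
    using unital_extension_exists[OF A A1 A(1) unital unitization_embedding[OF A(1) A1]] by blast
  have PA: "P a \<in> A" "P (P a) = P a" if "a \<in> A" for a
    using P that by (auto simp: real_positive_contractive_projection_def
        real_positive_contraction_def complex_linear_map_def)
  have "Q (Q x) = Q x" if "x \<in> A1" for x
    using that Q(3) PA by (auto simp: unitization_elements[OF A(1) A1])
  moreover have "Q (j a) = j (P a)" if "a \<in> A" for a
    using Q(3)[OF that, of 0] by simp
  ultimately show "\<exists>Q. real_positive_contractive_projection A1 Q \<and> unital_map A1 A1 Q \<and>
      (\<forall>a\<in>A. Q (j a) = j (P a))"
    using Q(1,2) by (auto simp: real_positive_contractive_projection_def)
qed

end
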